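(* Let $\mathcal X,\mathcal Y$ be real separable Hilbert spaces and $A:\mathcal X\to\mathcal Y$ a bounded linear operator with $\|A\|_{\mathrm{op}}\le1$. Let $X,\varepsilon$ be random variables with values in $\mathcal X$ and $\mathcal Y$ respectively, and let $Y=AX+\varepsilon$ almost surely. Assume: (i) $\mathbb E[\varepsilon|X]=0$ and there is $\tau>0$ with $\mathbb E[\|\varepsilon\|_{\mathcal Y}^2|X]\le\tau^2$; (ii) $J:\mathcal X\to\mathbb R\cup\{+\infty\}$ is a Legendre function; (iii) $x_0\in\mathrm{int}(\mathrm{dom}\,J)$ and $r>0$ are such that $B:=\{x\in\mathcal X:\|x-x_0\|\le r\}\subseteq\mathrm{int}(\mathrm{dom}\,J)$, there is $R>0$ with $\sup_{x\in B}\|\nabla J(x)\|\le R$, and $X\in B$ a.s.; (iv) there are a $\mathcal Y$-valued random variable $Z$, measurable with respect to the $\sigma$-algebra generated by $X$, and $\beta>0$, such that $A^*Z\in\partial J(X)$ a.s. and $\mathbb E[\|Z\|_{\mathcal Y}^2]\le\beta^2$; (v) $\Lambda=\{\lambda_1,\dots,\lambda_N\}$ with $N\ge2$, $0<\lambda_1\le\dots\le\lambda_N<\infty$, $\lambda_j=\lambda_1Q^{j-1}$ for $j=1,\dots,N$, where $Q=(\lambda_N/\lambda_1)^{1/(N-1)}$, and $\lambda_*=\tau/\beta\in[\lambda_1,\lambda_N]$. For each $\lambda\in(0,+\infty)$ let $f_\lambda:\mathcal Y\to\mathcal X$ be measurable and such that $X_\lambda:=f_\lambda(Y)$ satisfies,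 almost surely, $$X_\lambda\in\arg\min_{x\in\mathcal X}\tfrac12\|Ax-Y\|_{\mathcal Y}^2+\lambda J(x).$$ Let $(Y_i,X_i)_{i=1}^n$ be independent copies of $(Y,X)$, put $X_\lambda^i=f_\lambda(Y_i)$, and let $$\widehat\lambda_\Lambda\in\arg\min_{\lambda\in\Lambda}\frac1n\sum_{i=1}^nD_J(\pi_B(X_i),\pi_B(X_\lambda^i)),$$ and $L(X_\lambda)=\mathbb E[D_J(\pi_B(X),\pi_B(X_\lambda))]$. Let $\eta\in(0,1)$. Then, with probability at least $1-\eta$, $$L(X_{\widehat\lambda_\Lambda})\le\frac{1+Q^2}{Q}\beta\tau+\frac{26Rr}{n}\log\frac{2N}{\eta}.$$
   Context: $\partial J$ is the convex subdifferential, with $\mathrm{dom}(\partial J)=\{x:\partial J(x)\ne\emptyset\}$. A proper, convex, lower semicontinuous function $J:\mathcal X\to\mathbb R\cup\{+\infty\}$ is essentially smooth if $\partial J$ is locally bounded and single valued on its domain; it is essentially strictly convex if $(\partial J)^{-1}$ is locally bounded on its domain and $J$ is strictly convex on every convex subset of $\mathrm{dom}(\partial J)$; it is Legendre if it is both essentially smooth and essentially strictly convex. For a Legendre function, $\mathrm{dom}(\partial J)=\mathrm{int}(\mathrm{dom}\,J)$ (Bauschke–Borwein–Combettes), and $\nabla J(x)$ denotes the unique element of $\partial J(x)$ for $x\in\mathrm{int}(\mathrm{dom}\,J)$. The Bregman divergence is $D_J(x,x')=J(x)-J(x')-\langle\nabla J(x'),x-x'\rangle_{\mathcal X}$ if $x'\in\mathrm{int}(\mathrm{dom}\,J)$,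 and $+\infty$ otherwise. The Bregman projection onto $B$ is $\pi_B(x)=\arg\min_{z\in B}D_J(z,x)$; for $x\in\mathrm{int}(\mathrm{dom}\,J)$ it exists and is unique because $J$ is Legendre (Bauschke–Borwein–Combettes). It is a standing assumption that the minimizers defining $X_\lambda$ exist and can be selected measurably. The parameter $\widehat\lambda_\Lambda$ is a random variable depending on the sample, and $L(X_{\widehat\lambda_\Lambda})$ denotes the value of the deterministic function $\lambda\mapsto L(X_\lambda)$ at $\lambda=\widehat\lambda_\Lambda$; the probability is with respect to the sample. *)

theory Defs
  imports "HOL-Probability.Probability"
begin

section \<open>Extended-valued convex functions\<close>

definition effdom :: "('a \<Rightarrow> ereal) \<Rightarrow> 'a set" where
  "effdom J = {x. J x < \<infinity>}"

definition proper_fun :: "('a \<Rightarrow> ereal) \<Rightarrow> bool" where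
  "proper_fun J \<longleftrightarrow> effdom J \<noteq> {} \<and> (\<forall>x. J x \<noteq> -\<infinity>)"

text \<open>In \<open>ereal\<close>, \<open>0 * \<infinity> = 0\<close>, so the endpoints \<open>t = 0\<close> and \<open>t = 1\<close> are harmless.\<close>

definition convex_fun :: "('a::real_vector \<Rightarrow> ereal) \<Rightarrow> bool" where
  "convex_fun J \<longleftrightarrow> (\<forall>x y. \<forall>t\<in>{0..1}.
     J ((1 - t) *\<^sub>R x + t *\<^sub>R y) \<le> ereal (1 - t) * J x + ereal t * J y)"

definition strictly_convex_fun_on :: "'a::real_vector set \<Rightarrow> ('a \<Rightarrow> ereal) \<Rightarrow> bool" where
  "strictly_convex_fun_on C J \<longleftrightarrow> (\<forall>x\<in>C. \<forall>y\<in>C. \<forall>t\<in>{0<..<1}. x \<noteq> y \<longrightarrow>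
     J ((1 - t) *\<^sub>R x + t *\<^sub>R y) < ereal (1 - t) * J x + ereal t * J y)"

definition lsc_fun :: "('a::topological_space \<Rightarrow> ereal) \<Rightarrow> bool" where
  "lsc_fun J \<longleftrightarrow> (\<forall>x. J x \<le> Liminf (nhds x) J)"

definition subdiff :: "('a::real_inner \<Rightarrow> ereal) \<Rightarrow> 'a \<Rightarrow> 'a set" where
  "subdiff J x = {p. x \<in> effdom J \<and> (\<forall>y. J x + ereal (p \<bullet> (y - x)) \<le> J y)}"


section \<open>Legendre functions\<close>

definition op_dom :: "('a \<Rightarrow> 'b set) \<Rightarrow> 'a set" where
  "op_dom T = {x. T x \<noteq> {}}"

definition op_inverse :: "('a \<Rightarrow> 'b set) \<Rightarrow> 'b \<Rightarrow> 'a set" where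
  "op_inverse T p = {x. p \<in> T x}"

definition locally_bounded_on_dom ::
    "('a::real_normed_vector \<Rightarrow> 'b::real_normed_vector set) \<Rightarrow> bool" where
  "locally_bounded_on_dom T \<longleftrightarrow>
     (\<forall>x\<in>op_dom T. \<exists>e>0. bounded (\<Union>y\<in>ball x e. T y))"

definition essentially_smooth :: "('a::real_inner \<Rightarrow> ereal) \<Rightarrow> bool" where
  "essentially_smooth J \<longleftrightarrow> locally_bounded_on_dom (subdiff J) \<and>
     (\<forall>x\<in>op_dom (subdiff J). \<exists>!p. p \<in> subdiff J x)"

definition essentially_strictly_convex :: "('a::real_inner \<Rightarrow> ereal) \<Rightarrow> bool" where
  "essentially_strictly_convex J \<longleftrightarrow> locally_bounded_on_dom (op_inverse (subdiff J)) \<and>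
     (\<forall>C. convex C \<and> C \<subseteq> op_dom (subdiff J) \<longrightarrow> strictly_convex_fun_on C J)"

definition legendre :: "('a::real_inner \<Rightarrow> ereal) \<Rightarrow> bool" where
  "legendre J \<longleftrightarrow> proper_fun J \<and> convex_fun J \<and> lsc_fun J \<and>
     essentially_smooth J \<and> essentially_strictly_convex J"

text \<open>Meaningful at points of \<open>interior (effdom J)\<close> for a Legendre function \<open>J\<close>, where the
  subdifferential is a singleton.\<close>

definition grad :: "('a::real_inner \<Rightarrow> ereal) \<Rightarrow> 'a \<Rightarrow> 'a" where
  "grad J x = (THE p. p \<in> subdiff J x)"


section \<open>Bregman divergence and projection\<close>

definition bregman_div :: "('a::real_inner \<Rightarrow> ereal) \<Rightarrow> 'a \<Rightarrow> 'a \<Rightarrow> ereal" where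
  "bregman_div J x x' =
     (if x' \<in> interior (effdom J) then J x - J x' - ereal (grad J x' \<bullet> (x - x')) else \<infinity>)"

definition bregman_proj :: "('a::real_inner \<Rightarrow> ereal) \<Rightarrow> 'a set \<Rightarrow> 'a \<Rightarrow> 'a" where
  "bregman_proj J B x = arg_min_on (\<lambda>z. bregman_div J z x) B"

text \<open>The expected loss of an estimator \<open>X'\<close> of \<open>X\<close>. Bregman divergences of convex functions are
  nonnegative, so \<open>e2ennreal\<close> does not truncate, and the Lebesgue integral in \<open>ennreal\<close>
  never collapses an infinite expectation to \<open>0\<close>.\<close>

definition bregman_risk ::
    "'w measure \<Rightarrow> ('a::real_inner \<Rightarrow> ereal) \<Rightarrow> 'a set \<Rightarrow> ('w \<Rightarrow> 'a) \<Rightarrow> ('w \<Rightarrow> 'a) \<Rightarrow> ennreal" where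
  "bregman_risk M J B X X' =
     (\<integral>\<^sup>+\<omega>. e2ennreal (bregman_div J (bregman_proj J B (X \<omega>)) (bregman_proj J B (X' \<omega>))) \<partial>M)"


section \<open>Conditional expectation of Banach-valued random variables\<close>

text \<open>\<open>g\<close> is a version of the conditional expectation of \<open>f\<close> given \<open>F\<close>; the library's
  \<open>real_cond_exp\<close> only covers real-valued \<open>f\<close>.\<close>

definition is_cond_exp :: "'w measure \<Rightarrow> 'w measure \<Rightarrow>
    ('w \<Rightarrow> 'b::{banach, second_countable_topology}) \<Rightarrow> ('w \<Rightarrow> 'b) \<Rightarrow> bool" where
  "is_cond_exp M F f g \<longleftrightarrow> integrable M f \<and> integrable M g \<and> g \<in> borel_measurable F \<and>
     (\<forall>S\<in>sets F. (LINT \<omega>:S|M. f \<omega>) = (LINT \<omega>:S|M. g \<omega>))"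

abbreviation generated_sigma ::
    "'w measure \<Rightarrow> ('w \<Rightarrow> 'b::topological_space) \<Rightarrow> 'w measure" where
  "generated_sigma M X \<equiv> vimage_algebra (space M) X borel"

end

theory Submission
  imports Defs
begin

text \<open>
  For fixed \<open>\<lambda>\<close> the first-order condition for \<open>X\<^sub>\<lambda>\<close> and the source condition bound the
  symmetrized Bregman distance of \<open>X\<close> and \<open>X\<^sub>\<lambda>\<close> by \<open>(\<lambda>/2) \<parallel>Z\<parallel>\<^sup>2 + \<parallel>\<epsilon>\<parallel>\<^sup>2/(2\<lambda>)\<close>, and projecting onto
  \<open>B\<close> only decreases the distance to \<open>X \<in> B\<close>. Hence the risk at \<open>\<lambda>\<close> is at most
  \<open>(\<lambda>\<beta>\<^sup>2 + \<tau>\<^sup>2/\<lambda>)/2\<close>, and the grid contains a \<open>\<lambda>\<close> within a factor \<open>Q\<close> of the optimum \<open>\<tau>/\<beta>\<close>.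
  The loss takes values in \<open>[0, 4Rr]\<close>; multiplicative Chernoff bounds, whose error is of order
  \<open>1/n\<close> at the price of a factor \<open>2\<close> in front of the best risk, control the empirical minimizer.

  The loss has to be Borel measurable for this. The preimage of a closed ball \<open>C\<close> under the
  projection consists of the points where the minima of the Bregman divergence over \<open>B \<inter> C\<close>
  and over \<open>B\<close> agree. Both minima are attained, and they depend upper semicontinuously on the
  point, because the gradient is norm-to-weak continuous.
\<close>


section \<open>Minimization over closed convex sets in Hilbert space\<close>

text \<open>Points of almost minimal norm in \<open>S n\<close> form a Cauchy sequence: the minimal
  norms increase and stay bounded, and the parallelogram identity controls the distances. The limit
  lies in every \<open>S n\<close>. This serves as the substitute for weak compactness of bounded
  closed convex sets.\<close>

lemma nested_closed_convex_Inter: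
  fixes S :: "nat \<Rightarrow> 'a::{real_inner, banach} set"
  assumes "\<And>n. closed (S n)" "\<And>n. convex (S n)" "\<And>n. S n \<noteq> {}" "decseq S" "bounded (S 0)"
  shows "(\<Inter>n. S n) \<noteq> {}"
proof -
  have sub: "S n \<subseteq> S m" if "m \<le> n" for m n
    using assms(4) that by (auto simp: decseq_def)
  obtain K where K: "\<And>x. x \<in> S 0 \<Longrightarrow> norm x \<le> K"
    using assms(5) by (auto simp: bounded_iff)
  define a where "a n = (INF x\<in>S n. (norm x)\<^sup>2)" for n
  have bb: "bdd_below ((\<lambda>x. (norm x)\<^sup>2) ` S n)" for n
    by (rule bdd_belowI[of _ 0]) auto
  have a_le: "a n \<le> (norm x)\<^sup>2" if "x \<in> S n" for n x
    unfolding a_def by (rule cINF_lower[OF bb that])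
  have "\<exists>x\<in>S n. (norm x)\<^sup>2 < a n + 1 / (real n + 1)" for n
  proof -
    have "a n < a n + 1 / (real n + 1)" by simp
    then show ?thesis
      unfolding a_def using cINF_less_iff[OF assms(3)[of n] bb] by blast
  qed
  then obtain p where pS: "\<And>n. p n \<in> S n" and p: "\<And>n. (norm (p n))\<^sup>2 < a n + 1 / (real n + 1)"
    by metis
  have mono: "incseq a"
    unfolding a_def incseq_def
    using sub assms(3) bb by (auto intro!: cINF_superset_mono)
  have "a n \<le> K\<^sup>2" for n
    using a_le[OF pS[of n]] K[of "p n"] pS[of n] sub[of 0 n] by (smt (verit) le0 norm_ge_zero power_mono subsetD)
  then obtain L where L: "a \<longlonglongrightarrow> L" and aL: "\<And>n. a n \<le> L"
    using incseq_convergent[OF mono] by metis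
  \<comment> \<open>Both points lie in the larger set \<open>S m\<close>, hence so does their
    midpoint, whose squared norm is at least \<open>a m\<close>.\<close>
  have est: "(norm (p m - p n))\<^sup>2 \<le> 4 * (L - a m) + 4 / (real m + 1)" if "m \<le> n" for m n
  proof -
    have "(1/2) *\<^sub>R p m + (1/2) *\<^sub>R p n \<in> S m"
      using assms(2) pS sub[OF that] by (intro convexD) auto
    from a_le[OF this] have "4 * a m \<le> (norm (p m + p n))\<^sup>2"
      by (simp add: scaleR_add_right[symmetric] power_divide)
    moreover have "(norm (p m - p n))\<^sup>2 + (norm (p m + p n))\<^sup>2 = 2 * (norm (p m))\<^sup>2 + 2 * (norm (p n))\<^sup>2"
      by (simp add: power2_norm_eq_inner inner_add_left inner_add_right inner_diff_left inner_diff_right)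
    moreover have "1 / (real n + 1) \<le> 1 / (real m + 1)"
      using that by (simp add: frac_le)
    ultimately show ?thesis
      using p[of m] p[of n] aL[of n] aL[of m] by argo
  qed
  have "(\<lambda>m. 1 / (real m + 1)) \<longlonglongrightarrow> 0"
    using LIMSEQ_inverse_real_of_nat by (simp add: inverse_eq_divide add.commute)
  from tendsto_add[OF tendsto_mult_left[OF tendsto_diff[OF tendsto_const L]] tendsto_mult_left[OF this], of 4 L 4]
  have lim0: "(\<lambda>m. 4 * (L - a m) + 4 / (real m + 1)) \<longlonglongrightarrow> 0" by simp
  have "Cauchy p"
  proof (rule CauchyI')
    fix e :: real assume "e > 0"
    then have "\<forall>\<^sub>F m in sequentially. 4 * (L - a m) + 4 / (real m + 1) < e\<^sup>2"
      using order_tendstoD(2)[OF lim0, of "e\<^sup>2"] by simp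
    then obtain M where "\<And>m. m \<ge> M \<Longrightarrow> 4 * (L - a m) + 4 / (real m + 1) < e\<^sup>2"
      by (auto simp: eventually_sequentially)
    then have "(norm (p m - p n))\<^sup>2 < e\<^sup>2" if "m \<ge> M" "n > m" for m n
      using est[of m n] that by fastforce
    then show "\<exists>M. \<forall>m\<ge>M. \<forall>n>m. dist (p m) (p n) < e"
      unfolding dist_norm
      using \<open>e > 0\<close> power_less_imp_less_base[of _ 2 e] by (metis less_imp_le)
  qed
  then obtain q where q: "p \<longlonglongrightarrow> q"
    using Cauchy_convergent convergent_def by blast
  have "q \<in> S n" for n
  proof (rule Lim_in_closed_set[OF assms(1) _ _ q])
    show "\<forall>\<^sub>F k in sequentially. p k \<in> S n"
      using pS sub by (auto simp: eventually_sequentially intro!: exI[of _ n])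
  qed simp
  then show ?thesis by auto
qed

text \<open>The sublevel sets at levels decreasing to the infimum are nested, and a common point
  attains the infimum, whether it is finite or \<open>-\<infinity>\<close>.\<close>

lemma quasiconvex_attains_min:
  fixes G :: "'a::{real_inner, banach} \<Rightarrow> ereal"
  assumes "\<And>c. closed {x. G x \<le> ereal c}" "\<And>c. convex {x. G x \<le> ereal c}"
    and "\<And>c. bounded {x. G x \<le> ereal c}" and u: "G u \<noteq> \<infinity>"
  obtains x where "\<And>z. G x \<le> G z"
proof -
  define I where "I = (INF z. G z)"
  have "I < \<infinity>" using u unfolding I_def by (metis INF_lower UNIV_I ereal_infty_less(1) order.strict_trans1)
  \<comment> \<open>The levels are \<open>I + 1 / (k + 1)\<close> for finite \<open>I\<close> and
    \<open>-k\<close> for \<open>I = -\<infinity>\<close>. The property \<open>lim\<close> states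
    convergence to \<open>I\<close> in a form common to both cases.\<close>
  then obtain c :: "nat \<Rightarrow> real" where cI: "\<And>k. I < ereal (c k)" and dec: "decseq c"
    and lim: "\<And>y. (\<And>k. y \<le> ereal (c k)) \<Longrightarrow> y \<le> I"
  proof (cases I)
    case (real i)
    show ?thesis
    proof (rule that[of "\<lambda>k. i + 1 / (real k + 1)"])
      show "decseq (\<lambda>k. i + 1 / (real k + 1))" by (auto simp: decseq_def frac_le)
      show "y \<le> I" if "\<And>k. y \<le> ereal (i + 1 / (real k + 1))" for y
      proof (rule ereal_le_epsilon2)
        fix e :: real assume "e > 0"
        then obtain k where "inverse (real (Suc k)) < e" using reals_Archimedean by blast
        then show "y \<le> I + ereal e"
          using order_trans[OF that[of k], of "ereal (i + e)"] real
          by (simp add: inverse_eq_divide add.commute)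
      qed
    qed (use real in auto)
  next
    case MInf
    show ?thesis
    proof (rule that[of "\<lambda>k. - real k"])
      show "y \<le> I" if "\<And>k. y \<le> ereal (- real k)" for y
      proof (rule ccontr)
        assume "\<not> y \<le> I"
        then have "y \<noteq> -\<infinity>" using MInf by auto
        moreover obtain k where "- real_of_ereal y < real k"
          using reals_Archimedean2 by blast
        ultimately show False using that[of k] by (cases y) auto
      qed
    qed (use MInf in \<open>auto simp: decseq_def\<close>)
  qed auto
  have "(\<Inter>k. {x. G x \<le> ereal (c k)}) \<noteq> {}"
  proof (rule nested_closed_convex_Inter)
    show "{x. G x \<le> ereal (c k)} \<noteq> {}" for k
      using cI[of k] unfolding I_def INF_less_iff by (auto intro: less_imp_le)
    show "decseq (\<lambda>k. {x. G x \<le> ereal (c k)})"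
      unfolding decseq_def
    proof (intro allI impI subsetI CollectI)
      fix m n x assume "m \<le> n" "x \<in> {x. G x \<le> ereal (c n)}"
      then show "G x \<le> ereal (c m)"
        using decseqD[OF dec, of m n] order_trans[of "G x" "ereal (c n)" "ereal (c m)"] by simp
    qed
  qed (use assms in auto)
  then obtain x where "\<And>k. G x \<le> ereal (c k)" by auto
  then have "G x \<le> I" by (rule lim)
  then show ?thesis
    using that[of x] unfolding I_def by (simp add: le_INF_iff)
qed


section \<open>Subdifferentials of closed convex functions\<close>

locale closed_convex_fun =
  fixes J :: "'x::{real_inner, banach} \<Rightarrow> ereal"
  assumes proper: "proper_fun J" and convex: "convex_fun J" and lsc: "lsc_fun J"
begin

text \<open>Outside \<open>effdom J\<close> the value is the default \<open>0\<close>, so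
  inequalities for \<open>j\<close> come with membership in \<open>effdom J\<close>.\<close>

definition j :: "'x \<Rightarrow> real" where "j x = real_of_ereal (J x)"

abbreviation "dom_sub \<equiv> op_dom (subdiff J)"

lemma not_MInf: "J x \<noteq> -\<infinity>"
  using proper by (simp add: proper_fun_def)

lemma J_eq: "x \<in> effdom J \<Longrightarrow> J x = ereal (j x)"
  using not_MInf[of x] by (cases "J x") (auto simp: effdom_def j_def)

lemma J_out: "x \<notin> effdom J \<Longrightarrow> J x = \<infinity>"
  by (auto simp: effdom_def)

lemma subdiff_iff:
  "p \<in> subdiff J x \<longleftrightarrow> x \<in> effdom J \<and> (\<forall>z\<in>effdom J. j x + p \<bullet> (z - x) \<le> j z)"
proof -
  have "J x + ereal (p \<bullet> (z - x)) \<le> J z \<longleftrightarrow> (z \<in> effdom J \<longrightarrow> j x + p \<bullet> (z - x) \<le> j z)"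
    if "x \<in> effdom J" for z
    using J_eq[OF that] J_eq[of z] J_out[of z] by (cases "z \<in> effdom J") auto
  then show ?thesis unfolding subdiff_def by auto
qed

lemma subdiffD:
  "p \<in> subdiff J x \<Longrightarrow> z \<in> effdom J \<Longrightarrow> j x + p \<bullet> (z - x) \<le> j z"
  "p \<in> subdiff J x \<Longrightarrow> x \<in> effdom J"
  by (auto simp: subdiff_iff)

lemma dom_sub_subset: "dom_sub \<subseteq> effdom J"
  by (auto simp: op_dom_def subdiff_iff)

lemma subdiff_monotone:
  assumes "p \<in> subdiff J x" "q \<in> subdiff J y"
  shows "(p - q) \<bullet> (x - y) \<ge> 0"
  using subdiffD(1)[OF assms(1) subdiffD(2)[OF assms(2)]]
    subdiffD(1)[OF assms(2) subdiffD(2)[OF assms(1)]]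
  by (simp add: inner_diff_left inner_diff_right)

lemma j_convex:
  assumes "x \<in> effdom J" "y \<in> effdom J" "t \<in> {0..1}"
  shows "(1 - t) *\<^sub>R x + t *\<^sub>R y \<in> effdom J"
    and "j ((1 - t) *\<^sub>R x + t *\<^sub>R y) \<le> (1 - t) * j x + t * j y"
proof -
  have le: "J ((1 - t) *\<^sub>R x + t *\<^sub>R y) \<le> ereal ((1 - t) * j x + t * j y)"
    using convex[unfolded convex_fun_def, rule_format, of t x y] assms
    by (simp add: J_eq[OF assms(1)] J_eq[OF assms(2)])
  then show *: "(1 - t) *\<^sub>R x + t *\<^sub>R y \<in> effdom J"
    unfolding effdom_def by auto
  show "j ((1 - t) *\<^sub>R x + t *\<^sub>R y) \<le> (1 - t) * j x + t * j y"
    using le J_eq[OF *] by simp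
qed

text \<open>Positivity of \<open>l\<close> matters: since \<open>0 * \<infinity> = 0\<close> in
  \<open>ereal\<close>, a zero weight would forget the effective domain.\<close>

lemma regularized_le_iff:
  assumes "l > 0"
  shows "ereal a + ereal l * J x \<le> ereal c \<longleftrightarrow> x \<in> effdom J \<and> a + l * j x \<le> c"
  using J_eq[of x] J_out[of x] assms by (cases "x \<in> effdom J") auto

lemma lsc_eventually:
  assumes "ereal a < J x"
  shows "\<forall>\<^sub>F w in nhds x. ereal a < J w"
  using lsc assms unfolding lsc_fun_def by (metis less_LiminfD order.strict_trans2)

text \<open>The complement is open: for a number \<open>a\<close> strictly between
  \<open>(c - q x) / l\<close> and \<open>J x\<close>, both \<open>J > a\<close> and
  \<open>q > c - l * a\<close> persist near \<open>x\<close>, and together they keep the sum above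
  \<open>c\<close>.\<close>

lemma closed_regularized_sublevel:
  assumes l: "l > 0" and q: "continuous_on UNIV q"
  shows "closed {x. ereal (q x) + ereal l * J x \<le> ereal c}"
proof -
  have "\<forall>\<^sub>F w in nhds x. \<not> ereal (q w) + ereal l * J w \<le> ereal c"
    if "\<not> ereal (q x) + ereal l * J x \<le> ereal c" for x
  proof -
    have "ereal ((c - q x) / l) < J x"
      using that l J_out[of x] J_eq[of x] unfolding regularized_le_iff[OF l]
      by (cases "x \<in> effdom J") (auto simp: field_simps)
    then obtain a where a: "(c - q x) / l < a" "ereal a < J x"
      using ereal_dense2 by (metis less_ereal.simps(1))
    have "\<forall>\<^sub>F w in nhds x. c - l * a < q w"
      using q a(1) l order_tendstoD(1)[of q "q x" "nhds x" "c - l * a"]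
      by (simp add: continuous_on_def tendsto_at_within_iff_tendsto_nhds field_simps)
    then show ?thesis
      using lsc_eventually[OF a(2)]
    proof eventually_elim
      case (elim w)
      show ?case
      proof
        assume "ereal (q w) + ereal l * J w \<le> ereal c"
        then have w: "w \<in> effdom J" "q w + l * j w \<le> c"
          unfolding regularized_le_iff[OF l] by auto
        have "l * a < l * j w" using elim(2) J_eq[OF w(1)] l by simp
        then show False using elim(1) w(2) by simp
      qed
    qed
  qed
  then have "open (- {x. ereal (q x) + ereal l * J x \<le> ereal c})"
    unfolding open_subopen[of "- _"] eventually_nhds
    by (metis (no_types, lifting) ComplI Compl_iff mem_Collect_eq subsetI)
  then show ?thesis by (simp add: closed_def)
qed

lemma le_of_nearby_le:
  assumes "\<And>d. d > 0 \<Longrightarrow> \<exists>u\<in>ball y d. J u \<le> ereal c"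
  shows "J y \<le> ereal c"
proof (rule ccontr)
  assume "\<not> ?thesis"
  then have "\<forall>\<^sub>F w in nhds y. ereal c < J w"
    by (intro lsc_eventually) simp
  then obtain d where "d > 0" "\<And>w. w \<in> ball y d \<Longrightarrow> ereal c < J w"
    unfolding eventually_nhds_metric by (auto simp: dist_commute)
  then show False using assms[of d] by force
qed

section \<open>First-order conditions and proximal points\<close>

text \<open>The minimizer is compared with points on the segment towards \<open>z\<close>, and the
  step length tends to zero. The second conclusion is the optimality condition in variational form,
  stated without the adjoint of \<open>A\<close>.\<close>

lemma regularized_argmin:
  assumes A: "linear A" and l: "l > 0"
    and x: "is_arg_min (\<lambda>x. ereal (1 / 2 * (norm (A x - y))\<^sup>2) + ereal l * J x) (\<lambda>_. True) x"
  shows "x \<in> effdom J" and "z \<in> effdom J \<Longrightarrow> l * j x + (y - A x) \<bullet> A (z - x) \<le> l * j z"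
proof -
  define q where "q x = 1 / 2 * (norm (A x - y))\<^sup>2" for x
  have min: "ereal (q x) + ereal l * J x \<le> ereal (q z) + ereal l * J z" for z
    using x unfolding is_arg_min_def q_def by (simp add: not_less)
  obtain u where u: "u \<in> effdom J" using proper by (auto simp: proper_fun_def)
  have *: "x \<in> effdom J \<and> q x + l * j x \<le> q z + l * j z" if "z \<in> effdom J" for z
    using min[of z] J_eq[OF that] regularized_le_iff[OF l, of "q x" x "q z + l * j z"] by simp
  show xd: "x \<in> effdom J" using *[OF u] by simp
  assume z: "z \<in> effdom J"
  define d where "d = A (z - x)"
  \<comment> \<open>The quadratic term is expanded exactly and \<open>j\<close> is bounded by
    convexity; division by \<open>t\<close> leaves an error of order \<open>t\<close>.\<close>
  have ineq: "l * j x + (y - A x) \<bullet> d \<le> l * j z + t * ((norm d)\<^sup>2 / 2)" if t: "t \<in> {0<..1}" for t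
  proof -
    let ?w = "(1 - t) *\<^sub>R x + t *\<^sub>R z"
    have w: "?w \<in> effdom J" "j ?w \<le> (1 - t) * j x + t * j z"
      using j_convex[OF xd z, of t] t by auto
    have "A ?w - y = (A x - y) + t *\<^sub>R d"
      unfolding d_def using A by (simp add: linear_add linear_diff linear_scale algebra_simps)
    then have "q ?w = q x + t * ((A x - y) \<bullet> d) + t\<^sup>2 * ((norm d)\<^sup>2 / 2)"
      unfolding q_def power2_norm_eq_inner
      by (simp add: inner_add_left inner_add_right inner_commute algebra_simps power2_eq_square)
    moreover have "l * j ?w \<le> l * ((1 - t) * j x + t * j z)"
      using w(2) l by simp
    ultimately have "t * (l * j x) \<le> t * ((A x - y) \<bullet> d + t * ((norm d)\<^sup>2 / 2) + l * j z)"
      using *[OF w(1)] by (simp add: algebra_simps power2_eq_square)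
    then show ?thesis using t by (simp add: inner_diff_left)
  qed
  have "((\<lambda>t. l * j z + t * ((norm d)\<^sup>2 / 2)) \<longlongrightarrow> l * j z + 0 * ((norm d)\<^sup>2 / 2)) (at_right 0)"
    by (intro tendsto_intros)
  moreover have "\<forall>\<^sub>F t in at_right 0. l * j x + (y - A x) \<bullet> d \<le> l * j z + t * ((norm d)\<^sup>2 / 2)"
    unfolding eventually_at_right_field using ineq by (intro exI[of _ 1]) auto
  ultimately show "l * j x + (y - A x) \<bullet> d \<le> l * j z"
    by (intro tendsto_lowerbound[of "\<lambda>t. l * j z + t * ((norm d)\<^sup>2 / 2)"]) auto
qed

text \<open>The minorant makes the quadratically regularized functional coercive, so a minimizer
  exists. Its first-order condition with \<open>A = id\<close> is the claimed inclusion.\<close>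

lemma prox_exists:
  assumes minorant: "\<And>x. x \<in> effdom J \<Longrightarrow> a - b * norm x \<le> j x" and l: "l > 0"
  obtains x where "(1 / l) *\<^sub>R (y - x) \<in> subdiff J x"
proof -
  define q where "q x = 1 / 2 * (norm (x - y))\<^sup>2" for x
  define G where "G x = ereal (q x) + ereal l * J x" for x
  have G: "G x \<le> ereal c \<longleftrightarrow> x \<in> effdom J \<and> q x + l * j x \<le> c" for x c
    unfolding G_def by (rule regularized_le_iff[OF l])
  obtain u where u: "u \<in> effdom J" using proper by (auto simp: proper_fun_def)
  obtain x where "\<And>z. G x \<le> G z"
  proof (rule quasiconvex_attains_min)
    show "closed {x. G x \<le> ereal c}" for c
      unfolding G_def q_def by (intro closed_regularized_sublevel l continuous_intros)
    show "convex {x. G x \<le> ereal c}" for c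
      unfolding convex_alt
    proof (intro ballI allI impI, unfold mem_Collect_eq G)
      fix x z and t :: real
      assume xz: "x \<in> effdom J \<and> q x + l * j x \<le> c" "z \<in> effdom J \<and> q z + l * j z \<le> c"
        and t: "0 \<le> t \<and> t \<le> 1"
      let ?w = "(1 - t) *\<^sub>R x + t *\<^sub>R z"
      have w: "?w \<in> effdom J" "j ?w \<le> (1 - t) * j x + t * j z"
        using j_convex[of x z t] xz t by auto
      have "q ?w = (1 - t) * q x + t * q z - t * (1 - t) / 2 * (norm (x - z))\<^sup>2"
        unfolding q_def power2_norm_eq_inner
        by (simp add: inner_add_left inner_add_right inner_diff_left inner_diff_right
            inner_commute algebra_simps power2_eq_square) (simp add: field_simps)
      then have "q ?w \<le> (1 - t) * q x + t * q z"
        using t by simp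
      moreover have "l * j ?w \<le> l * ((1 - t) * j x + t * j z)"
        using w(2) l by simp
      ultimately have "q ?w + l * j ?w \<le> (1 - t) * (q x + l * j x) + t * (q z + l * j z)"
        by (simp add: algebra_simps)
      also have "\<dots> \<le> (1 - t) * c + t * c"
        using xz t by (intro add_mono mult_left_mono) auto
      finally show "?w \<in> effdom J \<and> q ?w + l * j ?w \<le> c"
        using w(1) by (simp add: algebra_simps)
    qed
    show "bounded {x. G x \<le> ereal c}" for c
    proof (rule boundedI, unfold mem_Collect_eq G)
      fix x assume x: "x \<in> effdom J \<and> q x + l * j x \<le> c"
      define s where "s = norm (x - y)"
      define b' where "b' = l * \<bar>b\<bar>"
      define c' where "c' = \<bar>c - l * a + b' * norm y\<bar>"
      have "b * norm x \<le> \<bar>b\<bar> * (s + norm y)"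
        unfolding s_def using norm_triangle_sub[of x y] by (intro mult_mono) auto
      then have "l * (a - \<bar>b\<bar> * (s + norm y)) \<le> l * j x"
        using minorant[of x] x l by (intro mult_left_mono) auto
      \<comment> \<open>On a sublevel set the square of \<open>s\<close> is dominated by an affine
        function of \<open>s\<close>, which bounds \<open>s\<close>.\<close>
      then have "1 / 2 * s\<^sup>2 \<le> c' + b' * s"
        using x abs_ge_self[of "c - l * a + b' * norm y"]
        unfolding q_def s_def[symmetric] c'_def[symmetric] by (simp add: algebra_simps b'_def)
      then have "s * s \<le> 2 * c' + 2 * b' * s" by (simp add: power2_eq_square)
      moreover have "b' \<ge> 0" "c' \<ge> 0" using l by (auto simp: b'_def c'_def)
      ultimately have "s \<le> 1 + 2 * c' + 2 * b'"
      proof -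
        assume *: "s * s \<le> 2 * c' + 2 * b' * s" "b' \<ge> 0" "c' \<ge> 0"
        show ?thesis
        proof (cases "s \<ge> 1")
          case True
          then have "2 * c' \<le> 2 * c' * s" using *(3) by (simp add: mult_le_cancel_left1)
          then have "s * s \<le> (2 * c' + 2 * b') * s" using *(1) by (simp add: algebra_simps)
          then show ?thesis using True by simp
        qed (use * in auto)
      qed
      then show "norm x \<le> 1 + 2 * c' + 2 * b' + norm y"
        unfolding s_def using norm_triangle_sub[of x y] by simp
    qed
    show "G u \<noteq> \<infinity>" unfolding G_def using J_eq[OF u] by simp
  qed (rule that)
  then have "is_arg_min (\<lambda>x. ereal (1 / 2 * (norm (id x - y))\<^sup>2) + ereal l * J x) (\<lambda>_. True) x"
    unfolding is_arg_min_def G_def q_def by (simp add: not_less)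
  note am = regularized_argmin[OF linear_id l this]
  show ?thesis
  proof (rule that[of x], unfold subdiff_iff, intro conjI ballI)
    fix z assume "z \<in> effdom J"
    from am(2)[OF this] have "j x + ((y - x) \<bullet> (z - x)) / l \<le> j z"
      using l by (simp add: field_simps)
    then show "j x + (1 / l) *\<^sub>R (y - x) \<bullet> (z - x) \<le> j z" by simp
  qed (use am(1) in auto)
qed

text \<open>The set of bounded \<open>e\<close>-subgradients in \<open>C\<close> is closed, convex and bounded, and it decreases
  with \<open>e\<close>; this replaces weak sequential compactness of balls.\<close>

lemma subdiff_closed:
  assumes C: "closed C" "convex C"
    and approx: "\<And>d. d > 0 \<Longrightarrow> \<exists>u\<in>ball y d. \<exists>p\<in>subdiff J u \<inter> C. norm p \<le> K"
  obtains p where "p \<in> subdiff J y" "p \<in> C" "norm p \<le> K"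
proof -
  have K: "K \<ge> 0" using approx[of 1] by (meson norm_ge_zero order_trans zero_less_one)
  obtain v where v: "v \<in> effdom J" using proper by (auto simp: proper_fun_def)
  \<comment> \<open>Testing the bounded subgradients at nearby points against one fixed
    \<open>v\<close> bounds \<open>J\<close> there uniformly; lower semicontinuity carries the bound
    to \<open>y\<close>.\<close>
  have "J y \<le> ereal (j v + K * (norm (v - y) + 1))"
  proof (rule le_of_nearby_le)
    fix d :: real assume "d > 0"
    then obtain u p where u: "u \<in> ball y (min d 1)" "p \<in> subdiff J u" "norm p \<le> K"
      using approx[of "min d 1"] by auto
    have "norm (v - u) \<le> norm (v - y) + 1"
      using u(1) norm_triangle_ineq[of "v - y" "y - u"] by (simp add: dist_norm)
    then have "\<bar>p \<bullet> (v - u)\<bar> \<le> K * (norm (v - y) + 1)"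
      by (intro order_trans[OF Cauchy_Schwarz_ineq2] mult_mono u K) auto
    then have "j u \<le> j v + K * (norm (v - y) + 1)"
      using subdiffD(1)[OF u(2) v] by linarith
    then show "\<exists>u\<in>ball y d. J u \<le> ereal (j v + K * (norm (v - y) + 1))"
      using u(1) J_eq[OF subdiffD(2)[OF u(2)]] by (intro bexI[of _ u]) auto
  qed
  then have y: "y \<in> effdom J" by (auto simp: effdom_def)
  define S where "S n = C \<inter> cball 0 K \<inter>
    (\<Inter>z\<in>effdom J. {p. (z - y) \<bullet> p \<le> j z - j y + 1 / (real n + 1)})" for n
  have "(\<Inter>n. S n) \<noteq> {}"
  proof (rule nested_closed_convex_Inter)
    show "closed (S n)" for n
      unfolding S_def using C by (intro closed_Int closed_INT ballI closed_halfspace_le) auto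
    show "convex (S n)" for n
      unfolding S_def using C by (intro convex_Int convex_INT convex_halfspace_le) auto
    show "decseq S"
      unfolding decseq_def
    proof (intro allI impI)
      fix m n :: nat assume "m \<le> n"
      then have "1 / (real n + 1) \<le> 1 / (real m + 1)" by (simp add: frac_le)
      then show "S n \<subseteq> S m" unfolding S_def by fastforce
    qed
    show "bounded (S 0)" unfolding S_def by (meson bounded_Int bounded_cball)
    show "S n \<noteq> {}" for n
    proof -
      define e where "e = 1 / (real n + 1)"
      have e: "e > 0" by (simp add: e_def)
      have "ereal (j y - e / 2) < J y" using J_eq[OF y] e by simp
      from lsc_eventually[OF this] obtain d where d: "d > 0"
        "\<And>w. w \<in> ball y d \<Longrightarrow> ereal (j y - e / 2) < J w"
        unfolding eventually_nhds_metric by (auto simp: dist_commute)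
      \<comment> \<open>The error \<open>e\<close> is split in halves: one for lower semicontinuity
        of \<open>J\<close>, one for \<open>p \<bullet> (y - u)\<close>. The summand
        \<open>1\<close> keeps the denominator positive when \<open>K = 0\<close>.\<close>
      define d' where "d' = min d (e / (2 * (K + 1)))"
      have "d' > 0" using d e K by (simp add: d'_def)
      then obtain u p where u: "u \<in> ball y d'" "p \<in> subdiff J u" "p \<in> C" "norm p \<le> K"
        using approx[of d'] by auto
      have ju: "j y - e / 2 < j u"
        using d(2)[of u] u(1) J_eq[OF subdiffD(2)[OF u(2)]] by (simp add: d'_def)
      have "\<bar>p \<bullet> (y - u)\<bar> \<le> (K + 1) * (e / (2 * (K + 1)))"
        using u(1,4) by (intro order_trans[OF Cauchy_Schwarz_ineq2] mult_mono) (use K in \<open>auto simp: d'_def dist_norm\<close>)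
      also have "\<dots> = e / 2" using K by (simp add: field_simps)
      finally have pe: "\<bar>p \<bullet> (y - u)\<bar> \<le> e / 2" .
      have "(z - y) \<bullet> p \<le> j z - j y + e" if "z \<in> effdom J" for z
        using subdiffD(1)[OF u(2) that] pe ju
        unfolding inner_diff_right inner_diff_left inner_commute[of _ p] by linarith
      then have "p \<in> S n" unfolding S_def e_def using u by auto
      then show ?thesis by auto
    qed
  qed
  then obtain p where p: "\<And>n. p \<in> S n" by auto
  have "j y + p \<bullet> (z - y) \<le> j z" if z: "z \<in> effdom J" for z
  proof (rule field_le_epsilon)
    fix e :: real assume "e > 0"
    then obtain n where "inverse (real (Suc n)) < e" using reals_Archimedean by blast
    moreover have "(z - y) \<bullet> p \<le> j z - j y + 1 / (real n + 1)"
      using p[of n] z unfolding S_def by auto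
    ultimately show "j y + p \<bullet> (z - y) \<le> j z + e"
      by (simp add: inverse_eq_divide add.commute inner_commute)
  qed
  then have "p \<in> subdiff J y" using y by (simp add: subdiff_iff)
  then show ?thesis using p[of 0] that unfolding S_def by auto
qed

end

section \<open>Riesz representation and adjoints\<close>

text \<open>The representing vector is the proximal point of \<open>0\<close> for the function
  \<open>- \<phi>\<close> with parameter \<open>1\<close>, that is, the minimizer of half the
  squared norm minus \<open>\<phi>\<close>.\<close>

lemma Riesz_representation:
  fixes \<phi> :: "'x::{real_inner, banach} \<Rightarrow> real"
  assumes "bounded_linear \<phi>"
  obtains x where "\<And>z. \<phi> z = x \<bullet> z"
proof -
  interpret \<phi>: bounded_linear \<phi> by fact
  interpret L: closed_convex_fun "\<lambda>x. ereal (- \<phi> x)"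
  proof
    show "proper_fun (\<lambda>x. ereal (- \<phi> x))" by (auto simp: proper_fun_def effdom_def)
    show "convex_fun (\<lambda>x. ereal (- \<phi> x))"
      by (auto simp: convex_fun_def \<phi>.add \<phi>.scaleR)
    have "((\<lambda>x. ereal (- \<phi> x)) \<longlongrightarrow> ereal (- \<phi> x)) (nhds x)" for x
      using \<phi>.continuous_on[of UNIV, OF continuous_on_id] unfolding lim_ereal
      by (intro tendsto_minus) (simp add: continuous_on_def tendsto_at_within_iff_tendsto_nhds)
    then show "lsc_fun (\<lambda>x. ereal (- \<phi> x))"
      unfolding lsc_fun_def using lim_imp_Liminf by (metis nhds_neq_bot order_refl)
  qed
  have dom: "effdom (\<lambda>x. ereal (- \<phi> x)) = UNIV" by (auto simp: effdom_def)
  have j: "L.j x = - \<phi> x" for x by (simp add: L.j_def)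
  obtain k where k: "\<And>x. norm (\<phi> x) \<le> norm x * k" using \<phi>.bounded by blast
  obtain x where "(1 / 1) *\<^sub>R (0 - x) \<in> subdiff (\<lambda>x. ereal (- \<phi> x)) x"
  proof (rule L.prox_exists[of 0 k 1 0])
    show "0 - k * norm x \<le> L.j x" for x
      using k[of x] by (simp add: j mult.commute)
  qed auto
  then have *: "\<phi> z \<le> \<phi> x + x \<bullet> (z - x)" for z
    using L.subdiffD(1)[of "- x" x z] by (simp add: dom j)
  have "\<phi> z = x \<bullet> z" for z
    using *[of "x + z"] *[of "x - z"] by (simp add: \<phi>.add \<phi>.diff)
  then show ?thesis using that by blast
qed

text \<open>\<open>adjoint\<close> is defined by choice; the Riesz representation provides an
  operator with the required identity, so the chosen one has it as well.\<close>

lemma adjoint_Hilbert: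
  fixes A :: "'x::{real_inner, banach} \<Rightarrow> 'y::real_inner"
  assumes "bounded_linear A"
  shows "A x \<bullet> y = x \<bullet> adjoint A y"
proof -
  have "\<exists>w. \<forall>x. A x \<bullet> y = x \<bullet> w" for y
    using Riesz_representation[OF bounded_linear_compose[OF bounded_linear_inner_left assms, of y]]
    by (metis inner_commute)
  then have "\<exists>A'. \<forall>x y. A x \<bullet> y = x \<bullet> A' y" by metis
  then have "\<forall>x y. A x \<bullet> y = x \<bullet> adjoint A y"
    unfolding adjoint_def by (rule someI_ex)
  then show ?thesis by blast
qed


section \<open>Legendre functions\<close>

locale legendre_function =
  fixes J :: "'x::{real_inner, banach} \<Rightarrow> ereal"
  assumes legendre: "legendre J"

sublocale legendre_function \<subseteq> closed_convex_fun J
  using legendre by unfold_locales (auto simp: legendre_def)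

context legendre_function
begin

lemma subdiff_locally_bounded:
  assumes "x \<in> dom_sub"
  obtains e K where "e > 0" "\<And>w p. w \<in> ball x e \<Longrightarrow> p \<in> subdiff J w \<Longrightarrow> norm p \<le> K"
proof -
  obtain e where e: "e > 0" "bounded (\<Union>y\<in>ball x e. subdiff J y)"
    using legendre assms
    by (auto simp: legendre_def essentially_smooth_def locally_bounded_on_dom_def)
  then obtain K where "\<And>p. p \<in> (\<Union>y\<in>ball x e. subdiff J y) \<Longrightarrow> norm p \<le> K"
    by (auto simp: bounded_iff)
  then show ?thesis using that[of e K] e(1) by blast
qed

lemma grad_eq: "p \<in> subdiff J x \<Longrightarrow> grad J x = p"
  using legendre unfolding legendre_def essentially_smooth_def grad_def op_dom_def
  by (metis (mono_tags, lifting) empty_iff mem_Collect_eq the_equality)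

lemma grad_subdiff: "x \<in> dom_sub \<Longrightarrow> grad J x \<in> subdiff J x"
  using grad_eq unfolding op_dom_def by fastforce

text \<open>The proximal points of a point \<open>y\<close> near \<open>x\<close> stay in the ball where the subdifferential
  is bounded, so they converge to \<open>y\<close> along bounded subgradients.\<close>

lemma open_dom_sub: "open dom_sub"
  unfolding open_dist
proof
  fix x assume x: "x \<in> dom_sub"
  then obtain p where p: "p \<in> subdiff J x" by (auto simp: op_dom_def)
  obtain e K where e: "e > 0" and K: "\<And>w p. w \<in> ball x e \<Longrightarrow> p \<in> subdiff J w \<Longrightarrow> norm p \<le> K"
    using subdiff_locally_bounded[OF x] by blast
  have K0: "K \<ge> 0" using K[OF _ p] e by (meson centre_in_ball norm_ge_zero order_trans)
  have "y \<in> dom_sub" if y: "dist y x < e / 2" for y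
  proof -
    have "\<exists>q. q \<in> subdiff J y \<and> q \<in> UNIV \<and> norm q \<le> K"
    proof (rule subdiff_closed[of UNIV y K])
      fix d :: real assume d: "d > 0"
      \<comment> \<open>The bound \<open>\<mu> * norm p \<le> e / 2\<close> keeps the proximal point
        in \<open>ball x e\<close>, and \<open>\<mu> * K < d\<close> then puts it within
        \<open>d\<close> of \<open>y\<close>.\<close>
      define \<mu> where "\<mu> = min (e / (2 * (norm p + 1))) (d / (K + 1))"
      have \<mu>: "\<mu> > 0" using e d K0 by (simp add: \<mu>_def add_nonneg_pos)
      have "\<mu> * (norm p + 1) \<le> e / (2 * (norm p + 1)) * (norm p + 1)"
        unfolding \<mu>_def by (intro mult_right_mono) auto
      also have "\<dots> = e / 2"
        using add_pos_nonneg[OF zero_less_one norm_ge_zero[of p]] by (simp add: field_simps)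
      finally have \<mu>p: "\<mu> * norm p \<le> e / 2" using \<mu> by (simp add: algebra_simps)
      have "\<mu> * (K + 1) \<le> d / (K + 1) * (K + 1)"
        unfolding \<mu>_def using K0 by (intro mult_right_mono) auto
      also have "\<dots> = d" using K0 by simp
      finally have \<mu>K: "\<mu> * K < d" using \<mu> by (simp add: algebra_simps)
      obtain u where u: "(1 / \<mu>) *\<^sub>R (y - u) \<in> subdiff J u"
      proof (rule prox_exists[OF _ \<mu>])
        show "(j x - norm p * norm x) - norm p * norm z \<le> j z" if "z \<in> effdom J" for z
        proof -
          have "\<bar>p \<bullet> (z - x)\<bar> \<le> norm p * (norm z + norm x)"
            by (intro order_trans[OF Cauchy_Schwarz_ineq2] mult_left_mono norm_triangle_ineq4) auto
          then show ?thesis using subdiffD(1)[OF p that] by (simp add: algebra_simps)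
        qed
      qed
      let ?q = "(1 / \<mu>) *\<^sub>R (y - u)"
      \<comment> \<open>Monotonicity between \<open>u\<close> and \<open>x\<close> yields
        \<open>norm (u - x) \<le> norm (y - x) + \<mu> * norm p\<close>.\<close>
      have "0 \<le> \<mu> * ((?q - p) \<bullet> (u - x))"
        using subdiff_monotone[OF u p] \<mu> by simp
      also have "\<dots> = (y - u - \<mu> *\<^sub>R p) \<bullet> (u - x)"
        using \<mu> by (simp add: inner_diff_left right_diff_distrib inner_scaleR_left[symmetric] del: inner_scaleR_left)
      finally have "(u - x) \<bullet> (u - x) \<le> (y - x - \<mu> *\<^sub>R p) \<bullet> (u - x)"
        by (simp add: inner_diff_left)
      also have "\<dots> \<le> (norm (y - x) + \<mu> * norm p) * norm (u - x)"
        using norm_triangle_ineq4[of "y - x" "\<mu> *\<^sub>R p"] \<mu>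
        by (intro order_trans[OF norm_cauchy_schwarz] mult_right_mono) auto
      finally have "norm (u - x) * norm (u - x) \<le> (norm (y - x) + \<mu> * norm p) * norm (u - x)"
        by (simp add: power2_norm_eq_inner[symmetric] power2_eq_square)
      then have "norm (u - x) \<le> norm (y - x) + \<mu> * norm p"
        using \<mu> by (cases "u = x") auto
      then have "u \<in> ball x e"
        using y \<mu>p by (simp add: dist_norm norm_minus_commute)
      then have q: "norm ?q \<le> K" using K u by blast
      have "norm (y - u) = \<mu> * norm ?q" using \<mu> by simp
      also have "\<dots> < d"
        using mult_left_mono[OF q, of \<mu>] \<mu> \<mu>K by simp
      finally have "u \<in> ball y d" by (simp add: dist_norm)
      then show "\<exists>u\<in>ball y d. \<exists>p\<in>subdiff J u \<inter> UNIV. norm p \<le> K"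
        using u q by blast
    qed auto
    then show ?thesis by (auto simp: op_dom_def)
  qed
  then show "\<exists>e>0. \<forall>y. dist y x < e \<longrightarrow> y \<in> dom_sub"
    using e by (intro exI[of _ "e / 2"]) auto
qed

lemma dom_sub_interior: "dom_sub \<subseteq> interior (effdom J)"
  using open_dom_sub dom_sub_subset by (rule interior_maximal[rotated])

text \<open>\<open>B \<inter> dom_sub\<close> is relatively open because \<open>dom_sub\<close> is
  open, and closed because limits of bounded subgradients are subgradients. Connectedness thus
  spreads a single point with a subgradient over all of \<open>B\<close>.\<close>

lemma connected_subset_dom_sub:
  assumes B: "closed B" "connected B" "B \<inter> dom_sub \<noteq> {}" and R: "\<And>x. x \<in> B \<Longrightarrow> norm (grad J x) \<le> R"
  shows "B \<subseteq> dom_sub"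
proof -
  have "closed (B \<inter> dom_sub)"
    unfolding closed_limpt
  proof (intro allI impI)
    fix y assume "y islimpt (B \<inter> dom_sub)"
    then have lim: "\<exists>u\<in>ball y d. u \<in> B \<inter> dom_sub" if "d > 0" for d
      unfolding islimpt_approachable using that by (force simp: dist_commute)
    have "y \<in> B" using \<open>closed B\<close> lim by (metis IntE closed_approachable dist_commute mem_ball)
    moreover have "\<exists>q. q \<in> subdiff J y \<and> q \<in> UNIV \<and> norm q \<le> R"
    proof (rule subdiff_closed[of UNIV y R])
      show "\<exists>u\<in>ball y d. \<exists>p\<in>subdiff J u \<inter> UNIV. norm p \<le> R" if "d > 0" for d
        using lim[OF that] R grad_subdiff by blast
    qed auto
    ultimately show "y \<in> B \<inter> dom_sub" by (auto simp: op_dom_def)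
  qed
  then have "open (- (B \<inter> dom_sub))" by (rule open_Compl)
  moreover have "B \<subseteq> dom_sub \<union> - (B \<inter> dom_sub)" "dom_sub \<inter> - (B \<inter> dom_sub) \<inter> B = {}"
    by auto
  ultimately have "dom_sub \<inter> B = {} \<or> - (B \<inter> dom_sub) \<inter> B = {}"
    using connectedD[OF B(2) open_dom_sub] by blast
  then show ?thesis using B(3) by auto
qed

section \<open>Norm-to-weak continuity of the gradient\<close>

text \<open>Otherwise gradients at points tending to \<open>x\<close> stay bounded and in the closed
  half-space \<open>v \<bullet> p \<ge> a\<close>, so \<open>x\<close> has a subgradient there,
  which by uniqueness is \<open>grad J x\<close>.\<close>

lemma grad_eventually_less:
  assumes x: "x \<in> dom_sub" and a: "grad J x \<bullet> v < a"
  shows "\<forall>\<^sub>F w in nhds x. w \<in> dom_sub \<longrightarrow> grad J w \<bullet> v < a"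
proof (rule ccontr)
  assume not: "\<not> ?thesis"
  obtain e K where e: "e > 0" and K: "\<And>w p. w \<in> ball x e \<Longrightarrow> p \<in> subdiff J w \<Longrightarrow> norm p \<le> K"
    using subdiff_locally_bounded[OF x] by blast
  have "\<exists>p. p \<in> subdiff J x \<and> p \<in> {p. v \<bullet> p \<ge> a} \<and> norm p \<le> K"
  proof (rule subdiff_closed[of "{p. v \<bullet> p \<ge> a}" x K])
    fix d :: real assume "d > 0"
    then have "\<exists>w. dist w x < min d e \<and> w \<in> dom_sub \<and> grad J w \<bullet> v \<ge> a"
      using not e unfolding eventually_nhds_metric by (metis min_less_iff_conj not_less)
    then obtain w where "w \<in> ball x (min d e)" "w \<in> dom_sub" "grad J w \<bullet> v \<ge> a"
      unfolding mem_ball dist_commute[of x] by blast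
    then show "\<exists>u\<in>ball x d. \<exists>p\<in>subdiff J u \<inter> {p. v \<bullet> p \<ge> a}. norm p \<le> K"
      using K[of w "grad J w"] grad_subdiff[of w]
      by (intro bexI[of _ w] bexI[of _ "grad J w"]) (auto simp: inner_commute[of v])
  qed (auto simp: closed_halfspace_ge convex_halfspace_ge)
  then obtain p where "p \<in> subdiff J x" "v \<bullet> p \<ge> a" by blast
  then show False using grad_eq[of p x] a by (simp add: inner_commute)
qed

text \<open>Weak convergence treats the fixed vector \<open>v0\<close>; the local bound on the
  gradient absorbs the norm-null difference \<open>v i - v0\<close>.\<close>

lemma grad_inner_tendsto:
  assumes x: "x \<in> dom_sub" and u: "(u \<longlongrightarrow> x) F" and ud: "\<forall>\<^sub>F i in F. u i \<in> dom_sub"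
    and v: "(v \<longlongrightarrow> v0) F"
  shows "((\<lambda>i. grad J (u i) \<bullet> v i) \<longlongrightarrow> grad J x \<bullet> v0) F"
proof -
  have fl: "\<forall>\<^sub>F i in F. P (u i)" if "\<forall>\<^sub>F w in nhds x. w \<in> dom_sub \<longrightarrow> P w" for P
    using eventually_conj[OF eventually_compose_filterlim[OF that u] ud] by (auto elim: eventually_mono)
  have weak: "((\<lambda>i. grad J (u i) \<bullet> v0) \<longlongrightarrow> grad J x \<bullet> v0) F"
  proof (rule order_tendstoI)
    show "\<forall>\<^sub>F i in F. grad J (u i) \<bullet> v0 < a" if "grad J x \<bullet> v0 < a" for a
      by (rule fl) (rule grad_eventually_less[OF x that])
    show "\<forall>\<^sub>F i in F. a < grad J (u i) \<bullet> v0" if "a < grad J x \<bullet> v0" for a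
      using grad_eventually_less[OF x, of "- v0" "- a"] that by (intro fl) simp
  qed
  obtain e K where e: "e > 0" and K: "\<And>w p. w \<in> ball x e \<Longrightarrow> p \<in> subdiff J w \<Longrightarrow> norm p \<le> K"
    using subdiff_locally_bounded[OF x] by blast
  have "\<forall>\<^sub>F w in nhds x. w \<in> dom_sub \<longrightarrow> norm (grad J w) \<le> K"
    unfolding eventually_nhds_metric using e K grad_subdiff
    by (intro exI[of _ e]) (auto simp: dist_commute)
  then have "\<forall>\<^sub>F i in F. norm (grad J (u i)) \<le> K" by (rule fl)
  then have "\<forall>\<^sub>F i in F. norm (grad J (u i) \<bullet> (v i - v0)) \<le> norm (v i - v0) * K"
  proof eventually_elim
    case (elim i)
    have "norm (grad J (u i) \<bullet> (v i - v0)) \<le> norm (grad J (u i)) * norm (v i - v0)"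
      using Cauchy_Schwarz_ineq2 by simp
    also have "\<dots> \<le> K * norm (v i - v0)" using elim by (intro mult_right_mono) auto
    finally show ?case by (simp add: mult.commute)
  qed
  moreover have "((\<lambda>i. norm (v i - v0) * K) \<longlongrightarrow> 0) F"
    using tendsto_mult_right[OF tendsto_norm_zero[OF LIM_zero[OF v]], of K] by simp
  ultimately have "((\<lambda>i. grad J (u i) \<bullet> (v i - v0)) \<longlongrightarrow> 0) F"
    by (rule Lim_null_comparison)
  from tendsto_add[OF weak this] show ?thesis by (simp add: inner_diff_right)
qed

text \<open>The subgradient inequalities at \<open>x\<close> and at \<open>u i\<close> enclose
  \<open>j (u i)\<close> between two expressions tending to \<open>j x\<close>.\<close>

lemma j_tendsto:
  assumes x: "x \<in> dom_sub" and u: "(u \<longlongrightarrow> x) F" and ud: "\<forall>\<^sub>F i in F. u i \<in> dom_sub"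
  shows "((\<lambda>i. j (u i)) \<longlongrightarrow> j x) F"
proof (rule tendsto_sandwich)
  show "((\<lambda>i. j x + grad J x \<bullet> (u i - x)) \<longlongrightarrow> j x) F"
    using tendsto_add[OF tendsto_const tendsto_inner[OF tendsto_const LIM_zero[OF u]], of "j x" "grad J x"]
    by simp
  show "((\<lambda>i. j x + grad J (u i) \<bullet> (u i - x)) \<longlongrightarrow> j x) F"
    using tendsto_add[OF tendsto_const grad_inner_tendsto[OF x u ud LIM_zero[OF u]], of "j x"]
    by simp
  show "\<forall>\<^sub>F i in F. j x + grad J x \<bullet> (u i - x) \<le> j (u i)"
    using ud by eventually_elim (use subdiffD grad_subdiff[OF x] dom_sub_subset in blast)
  show "\<forall>\<^sub>F i in F. j (u i) \<le> j x + grad J (u i) \<bullet> (u i - x)"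
    using ud
  proof eventually_elim
    case (elim i)
    have "x \<in> effdom J" using x dom_sub_subset by blast
    from subdiffD(1)[OF grad_subdiff[OF elim] this] show ?case
      by (simp add: inner_diff_right)
  qed
qed

section \<open>The Bregman divergence as a real-valued function\<close>

definition D :: "'x \<Rightarrow> 'x \<Rightarrow> real" where "D z x = j z - j x - grad J x \<bullet> (z - x)"

lemma bregman_div_eq:
  assumes "z \<in> effdom J" "x \<in> dom_sub"
  shows "bregman_div J z x = ereal (D z x)"
  using assms J_eq[of z] J_eq[of x] dom_sub_interior dom_sub_subset
  by (auto simp: bregman_div_def D_def)

lemma D_nonneg: "z \<in> effdom J \<Longrightarrow> x \<in> dom_sub \<Longrightarrow> 0 \<le> D z x"
  using subdiffD(1)[OF grad_subdiff, of x z] by (simp add: D_def)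

text \<open>The right-hand side is the symmetrized distance \<open>D z x + D x z\<close>, and the
  second summand is nonnegative.\<close>

lemma D_le_inner:
  assumes "z \<in> dom_sub" "x \<in> dom_sub"
  shows "D z x \<le> (grad J z - grad J x) \<bullet> (z - x)"
proof -
  have "x \<in> effdom J" using assms dom_sub_subset by blast
  from subdiffD(1)[OF grad_subdiff[OF assms(1)] this] show ?thesis
    by (simp add: D_def inner_diff_left inner_diff_right)
qed

text \<open>Norm-to-weak continuity of the gradient suffices for joint continuity, since the
  gradient is paired with vectors that converge in norm.\<close>

lemma D_tendsto:
  assumes "z \<in> dom_sub" "x \<in> dom_sub" "(u \<longlongrightarrow> z) F" "(v \<longlongrightarrow> x) F"
    "\<forall>\<^sub>F i in F. u i \<in> dom_sub" "\<forall>\<^sub>F i in F. v i \<in> dom_sub"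
  shows "((\<lambda>i. D (u i) (v i)) \<longlongrightarrow> D z x) F"
  unfolding D_def using assms by (intro tendsto_intros j_tendsto grad_inner_tendsto)

lemma continuous_on_D: "continuous_on (dom_sub \<times> dom_sub) (\<lambda>(z, x). D z x)"
  unfolding continuous_on_def
proof clarify
  fix z x assume "z \<in> dom_sub" "x \<in> dom_sub"
  moreover have "\<forall>\<^sub>F w in at (z, x) within dom_sub \<times> dom_sub. w \<in> dom_sub \<times> dom_sub"
    by (simp add: eventually_at_filter)
  then have "\<forall>\<^sub>F w in at (z, x) within dom_sub \<times> dom_sub. fst w \<in> dom_sub"
    "\<forall>\<^sub>F w in at (z, x) within dom_sub \<times> dom_sub. snd w \<in> dom_sub"
    by (auto elim!: eventually_mono)
  ultimately have "((\<lambda>w. D (fst w) (snd w)) \<longlongrightarrow> D z x) (at (z, x) within dom_sub \<times> dom_sub)"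
    using tendsto_fst[OF tendsto_ident_at, of "(z, x)"] tendsto_snd[OF tendsto_ident_at, of "(z, x)"]
    by (intro D_tendsto) auto
  then show "((\<lambda>(z, x). D z x) \<longlongrightarrow> D z x) (at (z, x) within dom_sub \<times> dom_sub)"
    by (simp add: case_prod_beta')
qed

lemma continuous_on_D_left: "x \<in> dom_sub \<Longrightarrow> continuous_on dom_sub (\<lambda>z. D z x)"
  using continuous_on_compose2[OF continuous_on_D, of dom_sub "\<lambda>z. (z, x)"]
  by (force intro!: continuous_intros)

lemma continuous_on_D_right: "z \<in> dom_sub \<Longrightarrow> continuous_on dom_sub (\<lambda>x. D z x)"
  using continuous_on_compose2[OF continuous_on_D, of dom_sub "\<lambda>x. (z, x)"]
  by (force intro!: continuous_intros)

lemma D_convex: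
  assumes "z \<in> effdom J" "w \<in> effdom J" "t \<in> {0..1}"
  shows "D ((1 - t) *\<^sub>R z + t *\<^sub>R w) x \<le> (1 - t) * D z x + t * D w x"
  using j_convex(2)[OF assms] by (simp add: D_def inner_add_right inner_diff_right algebra_simps)

lemma D_attains_min:
  assumes C: "closed C" "convex C" "bounded C" "C \<noteq> {}" "C \<subseteq> dom_sub" and x: "x \<in> dom_sub"
  obtains p where "p \<in> C" "\<And>z. z \<in> C \<Longrightarrow> D p x \<le> D z x"
proof -
  \<comment> \<open>The value \<open>\<infinity>\<close> off \<open>C\<close> encodes the
    constraint, so that the unconstrained minimization result applies.\<close>
  define G where "G z = (if z \<in> C then ereal (D z x) else \<infinity>)" for z
  have G: "{z. G z \<le> ereal c} = {z\<in>C. D z x \<le> c}" for c by (auto simp: G_def)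
  obtain u where u: "u \<in> C" using C by auto
  obtain p where p: "\<And>z. G p \<le> G z"
  proof (rule quasiconvex_attains_min)
    show "closed {z. G z \<le> ereal c}" for c
      unfolding G by (intro continuous_on_closed_Collect_le C
          continuous_on_subset[OF continuous_on_D_left[OF x]] continuous_on_const)
    show "convex {z. G z \<le> ereal c}" for c
      unfolding G convex_alt
    proof (intro ballI allI impI CollectI conjI)
      fix z w and t :: real
      assume z: "z \<in> {z \<in> C. D z x \<le> c}" "w \<in> {z \<in> C. D z x \<le> c}" and t: "0 \<le> t \<and> t \<le> 1"
      then show "(1 - t) *\<^sub>R z + t *\<^sub>R w \<in> C" using C(2) by (auto simp: convex_alt)
      have "D ((1 - t) *\<^sub>R z + t *\<^sub>R w) x \<le> (1 - t) * D z x + t * D w x"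
        using z t C(5) dom_sub_subset by (intro D_convex) auto
      also have "\<dots> \<le> (1 - t) * c + t * c"
        using z t by (intro add_mono mult_left_mono) auto
      finally show "D ((1 - t) *\<^sub>R z + t *\<^sub>R w) x \<le> c" by (simp add: algebra_simps)
    qed
    show "bounded {z. G z \<le> ereal c}" for c
      unfolding G using C(3) by (rule bounded_subset) auto
    show "G u \<noteq> \<infinity>" using u by (simp add: G_def)
  qed (rule that)
  have "p \<in> C" using p[of u] u by (auto simp: G_def split: if_splits)
  moreover have "D p x \<le> D z x" if "z \<in> C" for z
    using p[of z] that \<open>p \<in> C\<close> by (simp add: G_def)
  ultimately show ?thesis using that by blast
qed

end

section \<open>Bregman projections\<close>

locale bregman_projection = legendre_function J for J :: "'x::{real_inner, banach} \<Rightarrow> ereal" +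
  fixes B :: "'x set"
  assumes B: "closed B" "convex B" "bounded B" "B \<noteq> {}" "B \<subseteq> dom_sub"
begin

abbreviation "proj \<equiv> bregman_proj J B"

lemma B_effdom: "z \<in> B \<Longrightarrow> z \<in> effdom J"
  using B dom_sub_subset by blast

text \<open>\<open>bregman_proj\<close> selects by choice; existence of a minimizer makes the
  selected point one.\<close>

lemma proj_min:
  assumes x: "x \<in> dom_sub"
  shows "proj x \<in> B" and "z \<in> B \<Longrightarrow> D (proj x) x \<le> D z x"
proof -
  have iff: "is_arg_min (\<lambda>z. bregman_div J z x) (\<lambda>z. z \<in> B) p \<longleftrightarrow> p \<in> B \<and> (\<forall>z\<in>B. D p x \<le> D z x)" for p
    using bregman_div_eq[OF B_effdom x] unfolding is_arg_min_def by (force simp: not_less)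
  obtain p where "p \<in> B" "\<And>z. z \<in> B \<Longrightarrow> D p x \<le> D z x"
    using D_attains_min[OF B x] by blast
  then have "\<exists>p. is_arg_min (\<lambda>z. bregman_div J z x) (\<lambda>z. z \<in> B) p" unfolding iff by blast
  then have "is_arg_min (\<lambda>z. bregman_div J z x) (\<lambda>z. z \<in> B) (proj x)"
    unfolding bregman_proj_def arg_min_on_def arg_min_def by (rule someI_ex)
  then show "proj x \<in> B" "z \<in> B \<Longrightarrow> D (proj x) x \<le> D z x" unfolding iff by auto
qed

text \<open>Since \<open>D\<close> differs from \<open>j\<close> by an affine function of its first
  argument, strict convexity of \<open>J\<close> on \<open>B\<close> would make the midpoint of two
  minimizers strictly better.\<close>

lemma proj_unique:
  assumes x: "x \<in> dom_sub" and p: "p \<in> B" "D p x \<le> D (proj x) x"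
  shows "proj x = p"
proof (rule ccontr)
  assume ne: "proj x \<noteq> p"
  let ?q = "proj x" and ?m = "(1 - 1/2) *\<^sub>R proj x + (1/2::real) *\<^sub>R p"
  have q: "?q \<in> B" by (rule proj_min(1)[OF x])
  have m: "?m \<in> B" using convexD[OF B(2) q p(1), of "1/2" "1/2"] by simp
  have "strictly_convex_fun_on B J"
    using legendre B(2,5) by (auto simp: legendre_def essentially_strictly_convex_def)
  then have "J ?m < ereal (1 - 1/2) * J ?q + ereal (1/2) * J p"
    unfolding strictly_convex_fun_on_def
    by (elim ballE[of _ _ ?q] ballE[of _ _ p] ballE[of _ _ "1/2"] impE) (use q p(1) ne in auto)
  then have "j ?m < (j ?q + j p) / 2"
    using J_eq[OF B_effdom[OF m]] J_eq[OF B_effdom[OF q]] J_eq[OF B_effdom[OF p(1)]]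
    by (simp add: field_simps)
  then have "D ?m x < (D ?q x + D p x) / 2"
    by (simp add: D_def inner_add_right inner_diff_right field_simps)
  then show False using proj_min(2)[OF x m] p(2) by simp
qed

lemma proj_id:
  assumes "x \<in> B" shows "proj x = x"
proof (rule proj_unique)
  show x: "x \<in> dom_sub" using assms B by blast
  show "D x x \<le> D (proj x) x"
    using D_nonneg[OF B_effdom[OF proj_min(1)[OF x]] x] by (simp add: D_def)
qed fact

text \<open>With \<open>p\<close> the projection of \<open>x'\<close>, the three-point identity
  gives \<open>D x x' = D x p + D p x' + (grad J p - grad J x') \<bullet> (x - p)\<close>; the last
  term is nonnegative by optimality of \<open>p\<close>.\<close>

lemma D_proj_le:
  assumes x: "x \<in> B" and x': "x' \<in> dom_sub"
  shows "D x (proj x') \<le> D x x'"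
proof -
  define p where "p = proj x'"
  have p: "p \<in> B" "p \<in> dom_sub" unfolding p_def using proj_min(1)[OF x'] B by auto
  \<comment> \<open>Optimality is tested along the segment from \<open>p\<close> to
    \<open>x\<close>. The increment of \<open>j\<close> is bounded by the gradient at the moved
    point, which is then sent to \<open>p\<close>.\<close>
  have ineq: "grad J x' \<bullet> (x - p) \<le> grad J (p + t *\<^sub>R (x - p)) \<bullet> (x - p)" if t: "t \<in> {0<..1}" for t
  proof -
    let ?w = "p + t *\<^sub>R (x - p)"
    have "?w = (1 - t) *\<^sub>R p + t *\<^sub>R x" by (simp add: algebra_simps)
    then have w: "?w \<in> B" using B(2) p(1) x t unfolding convex_alt by auto
    have "D p x' \<le> D ?w x'" unfolding p_def by (rule proj_min(2)[OF x' w[unfolded p_def]])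
    then have "t * (grad J x' \<bullet> (x - p)) \<le> j ?w - j p"
      by (simp add: D_def inner_add_right inner_diff_right algebra_simps)
    also have "\<dots> \<le> t * (grad J ?w \<bullet> (x - p))"
      using subdiffD(1)[OF grad_subdiff B_effdom[OF p(1)], of ?w] w B(5) by auto
    finally show ?thesis using t by simp
  qed
  have "((\<lambda>t. p + t *\<^sub>R (x - p)) \<longlongrightarrow> p + 0 *\<^sub>R (x - p)) (at_right 0)"
    by (intro tendsto_intros)
  then have lim: "((\<lambda>t. p + t *\<^sub>R (x - p)) \<longlongrightarrow> p) (at_right 0)" by simp
  have "((\<lambda>t. grad J (p + t *\<^sub>R (x - p)) \<bullet> (x - p)) \<longlongrightarrow> grad J p \<bullet> (x - p)) (at_right 0)"
    using topological_tendstoD[OF lim open_dom_sub p(2)]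
    by (intro grad_inner_tendsto[OF p(2) lim] tendsto_const)
  moreover have "\<forall>\<^sub>F t in at_right 0. grad J x' \<bullet> (x - p) \<le> grad J (p + t *\<^sub>R (x - p)) \<bullet> (x - p)"
    unfolding eventually_at_right_field using ineq by (intro exI[of _ 1]) auto
  ultimately have "grad J x' \<bullet> (x - p) \<le> grad J p \<bullet> (x - p)"
    by (intro tendsto_lowerbound) auto
  moreover have "0 \<le> D p x'" by (rule D_nonneg[OF B_effdom[OF p(1)] x'])
  ultimately show ?thesis
    unfolding p_def[symmetric] by (simp add: D_def inner_diff_right)
qed

text \<open>This is the pointwise form of the risk bound: both gradients lie in the range of the
  adjoint, so the symmetrized distance becomes a concave quadratic in
  \<open>A (x - x')\<close>.\<close>

lemma D_proj_regularized_le: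
  fixes A :: "'x \<Rightarrow> 'y::real_inner"
  assumes A: "bounded_linear A" and l: "l > 0" and x: "x \<in> B"
    and z: "adjoint A z \<in> subdiff J x"
    and x': "is_arg_min (\<lambda>w. ereal (1 / 2 * (norm (A w - (A x + e)))\<^sup>2) + ereal l * J w) (\<lambda>_. True) x'"
  shows "x' \<in> dom_sub" and "D x (proj x') \<le> l / 2 * (norm z)\<^sup>2 + 1 / (2 * l) * (norm e)\<^sup>2"
proof -
  interpret A: bounded_linear A by fact
  note am = regularized_argmin[OF A.linear l x']
  define g where "g = adjoint A ((1 / l) *\<^sub>R (A x + e - A x'))"
  have adj: "adjoint A v \<bullet> w = v \<bullet> A w" for v w
    using adjoint_Hilbert[OF A, of w v] by (simp add: inner_commute)
  have g: "g \<in> subdiff J x'"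
    unfolding subdiff_iff
  proof (intro conjI ballI)
    fix w assume "w \<in> effdom J"
    from am(2)[OF this] have "j x' + ((A x + e - A x') \<bullet> A (w - x')) / l \<le> j w"
      using l by (simp add: field_simps)
    then show "j x' + g \<bullet> (w - x') \<le> j w" by (simp add: g_def adj)
  qed (rule am(1))
  then show x'd: "x' \<in> dom_sub" by (auto simp: op_dom_def)
  \<comment> \<open>In these variables the symmetrized distance is
    \<open>h \<bullet> u - (1 / l) * (u \<bullet> u)\<close>, and completing the square bounds it by
    \<open>l / 4 * (norm h)\<^sup>2\<close>.\<close>
  define u where "u = A (x - x')"
  define h where "h = z - (1 / l) *\<^sub>R e"
  have "D x (proj x') \<le> D x x'" by (rule D_proj_le[OF x x'd])
  also have "\<dots> \<le> (adjoint A z - g) \<bullet> (x - x')"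
    using D_le_inner[of x x'] x B x'd grad_eq[OF z] grad_eq[OF g] by auto
  also have "\<dots> = z \<bullet> u - (1 / l) * ((u + e) \<bullet> u)"
    by (simp add: g_def inner_diff_left adj u_def A.diff algebra_simps)
  also have "\<dots> = h \<bullet> u - (1 / l) * (u \<bullet> u)"
    by (simp add: h_def inner_diff_left inner_add_left algebra_simps)
  also have "\<dots> \<le> l / 4 * (norm h)\<^sup>2"
  proof -
    have "0 \<le> l * (((1/2) *\<^sub>R h - (1 / l) *\<^sub>R u) \<bullet> ((1/2) *\<^sub>R h - (1 / l) *\<^sub>R u))"
      using l by simp
    also have "\<dots> = l / 4 * (norm h)\<^sup>2 - (h \<bullet> u - (1 / l) * (u \<bullet> u))"
      using l by (simp add: power2_norm_eq_inner inner_diff_left inner_diff_right inner_commute field_simps)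
    finally show ?thesis by simp
  qed
  \<comment> \<open>The parallelogram identity separates \<open>z\<close> from \<open>e\<close>, at
    the cost of a factor \<open>2\<close>.\<close>
  also have "\<dots> \<le> l / 4 * (2 * (norm z)\<^sup>2 + 2 * (1 / l)\<^sup>2 * (norm e)\<^sup>2)"
  proof -
    have "(norm (z - w))\<^sup>2 + (norm (z + w))\<^sup>2 = 2 * (norm z)\<^sup>2 + 2 * (norm w)\<^sup>2" for w
      by (simp add: power2_norm_eq_inner inner_diff_left inner_diff_right inner_add_left inner_add_right)
    from this[of "(1 / l) *\<^sub>R e"] zero_le_power2[of "norm (z + (1 / l) *\<^sub>R e)"]
    have "(norm h)\<^sup>2 \<le> 2 * (norm z)\<^sup>2 + 2 * (norm ((1 / l) *\<^sub>R e))\<^sup>2"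
      unfolding h_def by linarith
    then have "(norm h)\<^sup>2 \<le> 2 * (norm z)\<^sup>2 + 2 * (1 / l)\<^sup>2 * (norm e)\<^sup>2"
      by (simp add: power_mult_distrib power_divide)
    then show ?thesis using l by (intro mult_left_mono) auto
  qed
  also have "\<dots> = l / 2 * (norm z)\<^sup>2 + 1 / (2 * l) * (norm e)\<^sup>2"
    using l by (simp add: field_simps power2_eq_square)
  finally show "D x (proj x') \<le> l / 2 * (norm z)\<^sup>2 + 1 / (2 * l) * (norm e)\<^sup>2" .
qed

end

section \<open>Borel measurability of the projection and of the loss\<close>

text \<open>By the Lindelof property an open set is a countable union of closed balls: the balls
  \<open>ball c e\<close> with \<open>cball c e\<close> inside the set cover it.\<close>

lemma borel_measurable_vimage_cball:
  fixes h :: "'a \<Rightarrow> 'b::{metric_space, second_countable_topology}"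
  assumes "\<And>c e. h -` cball c e \<inter> space M \<in> sets M"
  shows "h \<in> borel_measurable M"
proof (rule borel_measurableI)
  fix S :: "'b set" assume S: "open S"
  define F where "F = {ball c e |c e. cball c e \<subseteq> S}"
  obtain F' where F': "F' \<subseteq> F" "countable F'" "\<Union>F' = \<Union>F"
    by (rule Lindelof[of F]) (auto simp: F_def)
  have "\<forall>b\<in>F'. \<exists>k. b \<subseteq> k \<and> k \<subseteq> S \<and> h -` k \<inter> space M \<in> sets M"
  proof
    fix b assume "b \<in> F'"
    then obtain c e where "b = ball c e" "cball c e \<subseteq> S" using F'(1) by (auto simp: F_def)
    then show "\<exists>k. b \<subseteq> k \<and> k \<subseteq> S \<and> h -` k \<inter> space M \<in> sets M"
      using assms[of c e] by (intro exI[of _ "cball c e"]) auto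
  qed
  then obtain k where k: "\<And>b. b \<in> F' \<Longrightarrow> b \<subseteq> k b \<and> k b \<subseteq> S \<and> h -` k b \<inter> space M \<in> sets M"
    by metis
  have "S \<subseteq> \<Union>F"
  proof
    fix x assume "x \<in> S"
    then obtain e where "e > 0" "cball x e \<subseteq> S" using S open_contains_cball by blast
    then show "x \<in> \<Union>F" unfolding F_def by (auto intro!: exI[of _ "ball x e"])
  qed
  have "S = (\<Union>b\<in>F'. k b)"
  proof
    have "S \<subseteq> \<Union>F'" using \<open>S \<subseteq> \<Union>F\<close> F'(3) by simp
    also have "\<dots> \<subseteq> (\<Union>b\<in>F'. k b)" using k by fastforce
    finally show "S \<subseteq> (\<Union>b\<in>F'. k b)" .
    show "(\<Union>b\<in>F'. k b) \<subseteq> S" using k by (intro UN_least) simp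
  qed
  then have "h -` S \<inter> space M = (\<Union>b\<in>F'. h -` k b \<inter> space M)" by auto
  also have "\<dots> \<in> sets M" using k F'(2) by (intro sets.countable_UN') auto
  finally show "h -` S \<inter> space M \<in> sets M" .
qed

lemma bregman_proj_measurable:
  fixes J :: "'x::{real_inner, banach, second_countable_topology} \<Rightarrow> ereal"
  assumes "bregman_projection J B" and b: "b \<in> B"
  shows "(\<lambda>x. if x \<in> op_dom (subdiff J) then bregman_proj J B x else b) \<in> borel_measurable borel"
    (is "?h \<in> _")
proof (rule borel_measurable_vimage_cball)
  interpret bregman_projection J B by fact
  fix c e
  define C where "C = B \<inter> cball c e"
  \<comment> \<open>\<open>lev S a\<close> collects the points of \<open>dom_sub\<close> at which
    the infimum of the divergence over \<open>S\<close> is below \<open>a\<close>. It is open as a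
    union of open sets.\<close>
  define lev where "lev S a = dom_sub \<inter> (\<Union>z\<in>S. dom_sub \<inter> (\<lambda>x. D z x) -` {..<a})" for S a
  have lev: "lev S a \<in> sets borel" if "S \<subseteq> B" for S a
  proof -
    have "open (dom_sub \<inter> (\<lambda>x. D z x) -` {..<a})" if "z \<in> S" for z
      using continuous_on_D_right[of z] that \<open>S \<subseteq> B\<close> B(5) open_dom_sub
      by (intro continuous_open_preimage) auto
    then show ?thesis unfolding lev_def by (intro borel_open open_Int open_dom_sub open_UN) auto
  qed
  \<comment> \<open>For rational levels \<open>a\<close> the right-hand side says that the infimum
    over \<open>C\<close> is below \<open>a\<close> whenever the one over \<open>B\<close> is.
    Attainment over \<open>C\<close> and uniqueness of the projection then place
    \<open>proj x\<close> in \<open>C\<close>.\<close>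
  have "{x\<in>dom_sub. proj x \<in> cball c e} =
      (\<Inter>a::rat. (dom_sub - lev B (of_rat a)) \<union> lev C (of_rat a))" (is "?L = ?R")
  proof (intro equalityI subsetI)
    fix x assume "x \<in> ?L"
    then have x: "x \<in> dom_sub" "proj x \<in> C" using proj_min(1)[of x] by (auto simp: C_def)
    then show "x \<in> ?R"
      using proj_min(2)[OF x(1)] unfolding lev_def by (auto intro: order.strict_trans1)
  next
    fix x assume R: "x \<in> ?R"
    have x: "x \<in> dom_sub" using R by (auto simp: lev_def)
    have trans: "\<exists>z\<in>C. D z x < of_rat a" if "D (proj x) x < of_rat a" for a
    proof -
      have "x \<in> lev B (of_rat a)" using that x proj_min(1)[OF x] by (auto simp: lev_def)
      then have "x \<in> lev C (of_rat a)" using R by blast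
      then show ?thesis by (auto simp: lev_def)
    qed
    obtain a where "D (proj x) x < of_rat a"
      using of_rat_dense[of "D (proj x) x" "D (proj x) x + 1"] by auto
    with trans have "C \<noteq> {}" by blast
    moreover have "closed C" "convex C" "bounded C" "C \<subseteq> dom_sub"
      using B by (auto simp: C_def intro: convex_Int bounded_subset)
    ultimately obtain p where p: "p \<in> C" "\<And>z. z \<in> C \<Longrightarrow> D p x \<le> D z x"
      using D_attains_min[of C x] x by blast
    have "D p x \<le> D (proj x) x"
    proof (rule ccontr)
      assume "\<not> ?thesis"
      then obtain a where "D (proj x) x < of_rat a" "of_rat a < D p x"
        using of_rat_dense[of "D (proj x) x" "D p x"] by auto
      then show False using trans p(2) by force
    qed
    then have "proj x = p" using p(1) x by (intro proj_unique) (auto simp: C_def)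
    then show "x \<in> ?L" using p(1) x by (auto simp: C_def)
  qed
  moreover have "?R \<in> sets borel"
    using lev[of B] lev[of C] borel_open[OF open_dom_sub]
    by (intro sets.countable_INT'' sets.Un sets.Diff) (auto simp: C_def)
  ultimately have L: "?L \<in> sets borel" by simp
  have "?h -` cball c e \<inter> space borel = ?L \<union> (if b \<in> cball c e then - dom_sub else {})"
    by (auto split: if_splits)
  then show "?h -` cball c e \<inter> space borel \<in> sets borel"
    using sets.Un[OF L borel_comp[OF borel_open[OF open_dom_sub]]] L by auto
qed


context bregman_projection
begin

text \<open>In the symmetrized distance the gradients differ by at most \<open>2 * R\<close> and the
  points by at most \<open>2 * r\<close>.\<close>

lemma D_le_diameter:
  assumes B': "B \<subseteq> cball x\<^sub>0 r" and R: "\<And>x. x \<in> B \<Longrightarrow> norm (grad J x) \<le> R"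
    and xw: "x \<in> B" "w \<in> B"
  shows "D x w \<le> 4 * R * r"
proof -
  have "D x w \<le> (grad J x - grad J w) \<bullet> (x - w)"
    using D_le_inner[of x w] xw B(5) by auto
  also have "\<dots> \<le> norm (grad J x - grad J w) * norm (x - w)"
    by (rule norm_cauchy_schwarz)
  also have "\<dots> \<le> (R + R) * (r + r)"
  proof (rule mult_mono)
    show gg: "norm (grad J x - grad J w) \<le> R + R"
      using norm_triangle_ineq4[of "grad J x" "grad J w"] R[OF xw(1)] R[OF xw(2)] by linarith
    show "norm (x - w) \<le> r + r"
      using dist_triangle2[of x w x\<^sub>0] subsetD[OF B' xw(1)] subsetD[OF B' xw(2)]
      by (simp add: dist_norm norm_minus_commute)
    show "0 \<le> R + R" using gg by (rule order_trans[OF norm_ge_zero])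
  qed simp
  finally show ?thesis by simp
qed

end

text \<open>The default \<open>b\<close> keeps both arguments of \<open>D\<close> inside
  \<open>B\<close>, so the loss is defined on the whole product space.\<close>

lemma bregman_loss_measurable:
  fixes J :: "'x::{real_inner, banach, second_countable_topology} \<Rightarrow> ereal"
  assumes "bregman_projection J B" and b: "b \<in> B"
  shows "(\<lambda>(x, x'). legendre_function.D J (if x \<in> B then x else b)
      (if x' \<in> op_dom (subdiff J) then bregman_proj J B x' else b)) \<in> borel_measurable (borel \<Otimes>\<^sub>M borel)"
proof -
  interpret bregman_projection J B by fact
  define cl where "cl x = (if x \<in> B then x else b)" for x
  define pr where "pr x = (if x \<in> dom_sub then proj x else b)" for x
  have [measurable]: "pr \<in> borel_measurable borel"
    unfolding pr_def by (rule bregman_proj_measurable[OF assms])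
  have [measurable]: "B \<in> sets borel" using B(1) by (rule borel_closed)
  have [measurable]: "cl \<in> borel_measurable borel" unfolding cl_def by measurable
  have U: "open (dom_sub \<times> dom_sub)" by (intro open_Times open_dom_sub)
  \<comment> \<open>Extending \<open>D\<close> by zero off the open set where it is continuous gives
    a Borel function; the loss is \<open>E\<close> composed with Borel maps.\<close>
  define E where "E w = indicator (dom_sub \<times> dom_sub) w *\<^sub>R (case w of (x, x') \<Rightarrow> D x x')" for w
  have [measurable]: "E \<in> borel_measurable (borel \<Otimes>\<^sub>M borel)"
    unfolding E_def borel_prod
    by (rule borel_measurable_continuous_on_indicator[OF borel_open[OF U] continuous_on_D])
  have "D (cl x) (pr x') = E (cl x, pr x')" for x x'
  proof -
    have "cl x \<in> dom_sub" "pr x' \<in> dom_sub"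
      using b B(5) proj_min(1)[of x'] by (auto simp: cl_def pr_def)
    then show ?thesis by (simp add: E_def)
  qed
  then have "(\<lambda>(x, x'). D (cl x) (pr x')) = (\<lambda>w. E (cl (fst w), pr (snd w)))"
    by auto
  also have "\<dots> \<in> borel_measurable (borel \<Otimes>\<^sub>M borel)" by measurable
  finally show ?thesis unfolding cl_def pr_def .
qed

section \<open>Risk of the empirical minimizer\<close>

lemma exp_mult_le_chord:
  fixes c w :: real
  assumes "w \<in> {0..1}"
  shows "exp (c * w) \<le> 1 + w * (exp c - 1)"
  using convex_onD[OF exp_convex, of w 0 c] assms by (simp add: algebra_simps)

context prob_space
begin

text \<open>Convexity bounds each exponential moment by \<open>1 + \<mu> * (exp c - 1)\<close>,
  hence by \<open>exp (\<mu> * (exp c - 1))\<close>; independence and the Markov inequality finish.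
  As \<open>c\<close> may have either sign, both tails are covered.\<close>

lemma unit_interval_Chernoff:
  fixes W :: "'i \<Rightarrow> 'a \<Rightarrow> real"
  assumes I: "finite I" and ind: "indep_vars (\<lambda>_. borel) W I"
    and W: "\<And>i \<omega>. i \<in> I \<Longrightarrow> \<omega> \<in> space M \<Longrightarrow> W i \<omega> \<in> {0..1}"
    and \<mu>: "\<And>i. i \<in> I \<Longrightarrow> expectation (W i) = \<mu>"
  shows "prob {\<omega>\<in>space M. card I * (\<mu> * (exp c - 1)) + l \<le> c * (\<Sum>i\<in>I. W i \<omega>)} \<le> exp (- l)"
proof -
  let ?a = "\<mu> * (exp c - 1)"
  have meas[measurable]: "W i \<in> borel_measurable M" if "i \<in> I" for i
    using ind that by (auto simp: indep_vars_def)
  have int: "integrable M (W i)" "integrable M (\<lambda>\<omega>. exp (c * W i \<omega>))" if i: "i \<in> I" for i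
  proof -
    show "integrable M (W i)"
      using meas[OF i] W[OF i] by (intro integrable_const_bound[of _ 1] AE_I2) auto
    have "exp (c * W i \<omega>) \<le> exp \<bar>c\<bar>" if "\<omega> \<in> space M" for \<omega>
    proof -
      have "c * W i \<omega> \<le> \<bar>c\<bar> * 1"
        using W[OF i that] by (intro mult_mono) auto
      then show ?thesis by simp
    qed
    then show "integrable M (\<lambda>\<omega>. exp (c * W i \<omega>))"
      using meas[OF i] by (intro integrable_const_bound[of _ "exp \<bar>c\<bar>"] AE_I2) auto
  qed
  have ind': "indep_vars (\<lambda>_. borel) (\<lambda>i \<omega>. exp (c * W i \<omega>)) I"
    by (rule indep_vars_compose2[OF ind]) simp
  have prod: "exp (c * (\<Sum>i\<in>I. W i \<omega>)) = (\<Prod>i\<in>I. exp (c * W i \<omega>))" for \<omega>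
    using I by (simp add: sum_distrib_left exp_sum)
  have "expectation (\<lambda>\<omega>. exp (c * (\<Sum>i\<in>I. W i \<omega>))) = (\<Prod>i\<in>I. expectation (\<lambda>\<omega>. exp (c * W i \<omega>)))"
    unfolding prod by (rule indep_vars_lebesgue_integral[OF I ind' int(2)])
  also have "\<dots> \<le> (\<Prod>i\<in>I. exp ?a)"
  proof (rule prod_mono, intro conjI)
    fix i assume i: "i \<in> I"
    have "expectation (\<lambda>\<omega>. exp (c * W i \<omega>)) \<le> expectation (\<lambda>\<omega>. 1 + W i \<omega> * (exp c - 1))"
      using int[OF i] exp_mult_le_chord W[OF i] by (intro integral_mono) auto
    also have "\<dots> = 1 + ?a"
      using int(1)[OF i] \<mu>[OF i] by (simp add: prob_space)
    also have "\<dots> \<le> exp ?a" by (rule exp_ge_add_one_self)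
    finally show "expectation (\<lambda>\<omega>. exp (c * W i \<omega>)) \<le> exp ?a" .
  qed simp
  also have "\<dots> = exp (card I * ?a)" by (simp add: exp_of_nat_mult)
  finally have mgf: "expectation (\<lambda>\<omega>. exp (c * (\<Sum>i\<in>I. W i \<omega>))) \<le> exp (card I * ?a)" .
  have intP: "integrable M (\<lambda>\<omega>. exp (c * (\<Sum>i\<in>I. W i \<omega>)))"
    unfolding prod by (rule indep_vars_integrable[OF I ind' int(2)])
  have "prob {\<omega>\<in>space M. card I * ?a + l \<le> c * (\<Sum>i\<in>I. W i \<omega>)} =
      prob {\<omega>\<in>space M. exp (card I * ?a + l) \<le> exp (c * (\<Sum>i\<in>I. W i \<omega>))}"
    by simp
  also have "\<dots> \<le> expectation (\<lambda>\<omega>. exp (c * (\<Sum>i\<in>I. W i \<omega>))) / exp (card I * ?a + l)"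
    by (rule integral_Markov_inequality_measure[OF intP]) auto
  also have "\<dots> \<le> exp (card I * ?a) / exp (card I * ?a + l)"
    using mgf by (rule divide_right_mono) simp
  also have "\<dots> = exp (- l)" by (simp flip: exp_diff)
  finally show ?thesis .
qed

text \<open>The tails are taken at \<open>c = ln 2\<close> for the fixed competitor \<open>k\<close> and at \<open>c = - ln 2\<close>
  for every candidate, which makes the constant in front of \<open>\<mu> k\<close> equal to \<open>2\<close>.\<close>

lemma empirical_minimizer_risk_bound:
  fixes W :: "'l \<Rightarrow> 'i \<Rightarrow> 'a \<Rightarrow> real" and hat :: "'a \<Rightarrow> 'l"
  assumes I: "finite I" "I \<noteq> {}" and \<Lambda>: "finite \<Lambda>" "card \<Lambda> < K" "k \<in> \<Lambda>"
    and ind: "\<And>l. l \<in> \<Lambda> \<Longrightarrow> indep_vars (\<lambda>_. borel) (W l) I"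
    and W: "\<And>l i \<omega>. l \<in> \<Lambda> \<Longrightarrow> i \<in> I \<Longrightarrow> W l i \<omega> \<in> {0..C}" and C: "C > 0"
    and \<mu>: "\<And>l i. l \<in> \<Lambda> \<Longrightarrow> i \<in> I \<Longrightarrow> expectation (W l i) = \<mu> l"
    and hat: "hat \<in> measurable M (count_space \<Lambda>)"
    and hat_min: "AE \<omega> in M. (\<Sum>i\<in>I. W (hat \<omega>) i \<omega>) \<le> (\<Sum>i\<in>I. W k i \<omega>)"
    and \<eta>: "0 < \<eta>"
  shows "prob {\<omega>\<in>space M. \<mu> (hat \<omega>) \<le> 2 * \<mu> k + 4 * C / card I * ln (K / \<eta>)} \<ge> 1 - \<eta>"
proof -
  define n where "n = card I"
  define L where "L = ln (K / \<eta>)"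
  \<comment> \<open>Rescaling by \<open>C\<close> brings the variables into the unit interval, and
    with \<open>L\<close> as above each tail event has probability at most
    \<open>\<eta> / K\<close>.\<close>
  define V where "V l i \<omega> = W l i \<omega> / C" for l i \<omega>
  define Bad where "Bad l c = {\<omega>\<in>space M. card I * (\<mu> l / C * (exp c - 1)) + L \<le> c * (\<Sum>i\<in>I. V l i \<omega>)}" for l c
  have n: "n > 0" using I by (simp add: n_def card_gt_0_iff)
  have K: "K > 0" using \<Lambda> by simp
  have meas: "W l i \<in> borel_measurable M" if "l \<in> \<Lambda>" "i \<in> I" for l i
    using ind that by (auto simp: indep_vars_def)
  have indV: "indep_vars (\<lambda>_. borel) (V l) I" if "l \<in> \<Lambda>" for l
    unfolding V_def by (rule indep_vars_compose2[OF ind[OF that]]) simp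
  have Bad: "prob (Bad l c) \<le> \<eta> / K" "Bad l c \<in> events" if l: "l \<in> \<Lambda>" for l c
  proof -
    have "prob (Bad l c) \<le> exp (- L)"
      unfolding Bad_def
    proof (rule unit_interval_Chernoff[OF I(1) indV[OF l]])
      show "V l i \<omega> \<in> {0..1}" if "i \<in> I" for i \<omega>
        using W[OF l that, of \<omega>] C by (auto simp: V_def)
      show "expectation (V l i) = \<mu> l / C" if "i \<in> I" for i
      proof -
        have "V l i = (\<lambda>\<omega>. W l i \<omega> / C)" by (simp add: V_def fun_eq_iff)
        then show ?thesis using \<mu>[OF l that] integral_divide_zero[of M "W l i" C] by simp
      qed
    qed
    also have "\<dots> = \<eta> / K" using \<eta> K by (simp add: L_def exp_minus)
    finally show "prob (Bad l c) \<le> \<eta> / K" .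
    have [measurable]: "(\<lambda>\<omega>. c * (\<Sum>i\<in>I. V l i \<omega>)) \<in> borel_measurable M"
      unfolding V_def using meas[OF l]
      by (intro borel_measurable_times borel_measurable_sum borel_measurable_divide) auto
    show "Bad l c \<in> events" unfolding Bad_def by measurable
  qed
  \<comment> \<open>One upper tail and \<open>card \<Lambda>\<close> lower tails make at most
    \<open>K\<close> events.\<close>
  define F where "F = Bad k (ln 2) \<union> (\<Union>l\<in>\<Lambda>. Bad l (- ln 2))"
  have F: "F \<in> events" unfolding F_def using Bad(2) \<Lambda> by auto
  have "prob F \<le> prob (Bad k (ln 2)) + prob (\<Union>l\<in>\<Lambda>. Bad l (- ln 2))"
    unfolding F_def using Bad(2) \<Lambda> by (intro measure_Un_le sets.finite_UN) auto
  also have "\<dots> \<le> prob (Bad k (ln 2)) + (\<Sum>l\<in>\<Lambda>. prob (Bad l (- ln 2)))"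
    using Bad(2) \<Lambda> by (intro add_left_mono measure_UNION_le) auto
  also have "\<dots> \<le> \<eta> / K + (\<Sum>l\<in>\<Lambda>. \<eta> / K)"
    using Bad(1) \<Lambda>(3) by (intro add_mono sum_mono) auto
  also have "\<dots> = (1 + card \<Lambda>) * (\<eta> / K)" by (simp add: algebra_simps)
  also have "\<dots> \<le> K * (\<eta> / K)" using \<Lambda>(2) \<eta> K by (intro mult_right_mono) auto
  also have "\<dots> = \<eta>" using K by simp
  finally have probF: "prob F \<le> \<eta>" .
  let ?T = "{\<omega>\<in>space M. \<mu> (hat \<omega>) \<le> 2 * \<mu> k + 4 * C / card I * ln (K / \<eta>)}"
  have "?T = hat -` {l\<in>\<Lambda>. \<mu> l \<le> 2 * \<mu> k + 4 * C / card I * ln (K / \<eta>)} \<inter> space M"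
    using measurable_space[OF hat] by auto
  also have "\<dots> \<in> events" by (rule measurable_sets[OF hat]) auto
  finally have T: "?T \<in> events" .
  have good: "\<mu> (hat \<omega>) \<le> 2 * \<mu> k + 4 * C / n * L"
    if w: "\<omega> \<in> space M" "\<omega> \<notin> F" and le: "(\<Sum>i\<in>I. W (hat \<omega>) i \<omega>) \<le> (\<Sum>i\<in>I. W k i \<omega>)" for \<omega>
  proof -
    have h: "hat \<omega> \<in> \<Lambda>" using measurable_space[OF hat w(1)] by simp
    define S where "S l = ln 2 * (\<Sum>i\<in>I. V l i \<omega>)" for l
    have "S (hat \<omega>) \<le> S k"
      unfolding S_def V_def using le C by (simp add: sum_divide_distrib[symmetric] divide_right_mono)
    moreover have "\<omega> \<notin> Bad k (ln 2)" "\<omega> \<notin> Bad (hat \<omega>) (- ln 2)"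
      using w(2) h by (auto simp: F_def)
    \<comment> \<open>\<open>exp c - 1\<close> equals \<open>1\<close> at \<open>c = ln 2\<close>
      and \<open>-1/2\<close> at \<open>c = - ln 2\<close>, whence the factor \<open>2\<close> and
      the error \<open>4 * C * L / n\<close>.\<close>
    then have "S k < n * (\<mu> k / C) + L" "- S (hat \<omega>) < - (n * (\<mu> (hat \<omega>) / C) / 2) + L"
      using w(1) unfolding Bad_def S_def n_def by (auto simp: exp_minus not_le)
    ultimately have "n * (\<mu> (hat \<omega>) / C) / 2 \<le> n * (\<mu> k / C) + 2 * L" by argo
    then show ?thesis using n C by (simp add: field_simps)
  qed
  have "1 - \<eta> \<le> 1 - prob F" using probF by simp
  also have "\<dots> = prob (space M - F)" using prob_compl[OF F] by simp
  also have "\<dots> \<le> prob ?T"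
  proof (rule finite_measure_mono_AE[OF _ T])
    show "AE \<omega> in M. \<omega> \<in> space M - F \<longrightarrow> \<omega> \<in> ?T"
      using hat_min by eventually_elim (use good in \<open>auto simp: n_def L_def\<close>)
  qed
  finally show ?thesis .
qed

end

section \<open>Approximation on a geometric grid\<close>

text \<open>For the largest grid point not above \<open>s\<close>, the ratio
  \<open>u = s / lam m\<close> lies in \<open>{1..Q}\<close>, where \<open>1 / u + u\<close> is
  largest at \<open>u = Q\<close>.\<close>

lemma geometric_grid_approximation:
  fixes lam :: "nat \<Rightarrow> real"
  assumes N: "N \<ge> 1" and pos: "0 < lam 1" and Q: "Q \<ge> 1"
    and grid: "\<And>j. j \<in> {1..N} \<Longrightarrow> lam j = lam 1 * Q ^ (j - 1)" and s: "s \<in> {lam 1..lam N}"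
  obtains m where "m \<in> {1..N}" "lam m / s + s / lam m \<le> (1 + Q\<^sup>2) / Q"
proof -
  define m where "m = Max {j\<in>{1..N}. lam j \<le> s}"
  have ne: "{j\<in>{1..N}. lam j \<le> s} \<noteq> {}" using s N by auto
  have m: "m \<in> {1..N}" "lam m \<le> s"
    using Max_in[OF _ ne] unfolding m_def[symmetric] by auto
  have mpos: "lam m > 0" using grid[OF m(1)] pos Q by simp
  have "s \<le> Q * lam m"
  proof (cases "m = N")
    case True
    then have "s \<le> 1 * lam m" using s by simp
    also have "\<dots> \<le> Q * lam m" using Q mpos by (intro mult_right_mono) auto
    finally show ?thesis .
  next
    case False
    then have m': "Suc m \<in> {1..N}" using m by auto
    have "\<not> lam (Suc m) \<le> s"
    proof
      assume "lam (Suc m) \<le> s"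
      then have "Suc m \<le> Max {j\<in>{1..N}. lam j \<le> s}" using m' by (intro Max_ge) auto
      then show False unfolding m_def[symmetric] by simp
    qed
    moreover have "lam (Suc m) = Q * lam m"
      using grid[OF m'] grid[OF m(1)] m(1) by (cases m) auto
    ultimately show ?thesis by simp
  qed
  define u where "u = s / lam m"
  have u: "1 \<le> u" "u \<le> Q" using m(2) \<open>s \<le> Q * lam m\<close> mpos by (auto simp: u_def field_simps)
  have "0 \<le> (Q - u) * (Q * u - 1) / (Q * u)"
    using u mult_mono[of 1 Q 1 u] by (intro divide_nonneg_nonneg mult_nonneg_nonneg) auto
  also have "\<dots> = (1 + Q\<^sup>2) / Q - (1 / u + u)"
    using u by (simp add: field_simps power2_eq_square)
  finally have "1 / u + u \<le> (1 + Q\<^sup>2) / Q" by simp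
  then have "lam m / s + s / lam m \<le> (1 + Q\<^sup>2) / Q" by (simp add: u_def)
  then show ?thesis using that m(1) by blast
qed


section \<open>Risk of the parameter chosen from data\<close>

theorem corollary4:
  fixes M :: "'w measure"
    and A :: "'x::{real_inner, banach, second_countable_topology} \<Rightarrow>
              'y::{real_inner, banach, second_countable_topology}"
    and X :: "'w \<Rightarrow> 'x" and \<epsilon> Y Z :: "'w \<Rightarrow> 'y"
    and J :: "'x \<Rightarrow> ereal" and x\<^sub>0 :: 'x and B :: "'x set"
    and f :: "real \<Rightarrow> 'y \<Rightarrow> 'x"
    and Ys :: "nat \<Rightarrow> 'w \<Rightarrow> 'y" and Xs :: "nat \<Rightarrow> 'w \<Rightarrow> 'x"
    and lam :: "nat \<Rightarrow> real" and lam_hat :: "'w \<Rightarrow> real"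
    and \<tau> \<beta> r R Q \<eta> :: real and n N :: nat
  defines "B \<equiv> cball x\<^sub>0 r"
    and "Q \<equiv> (lam N / lam 1) powr (1 / (real N - 1))"
  assumes prob: "prob_space M"
    and A: "bounded_linear A" "onorm A \<le> 1"
    and rv: "X \<in> borel_measurable M" "\<epsilon> \<in> borel_measurable M" "Y \<in> borel_measurable M"
    and model: "AE \<omega> in M. Y \<omega> = A (X \<omega>) + \<epsilon> \<omega>"
    and noise_mean: "is_cond_exp M (generated_sigma M X) \<epsilon> (\<lambda>_. 0)"
    and tau: "\<tau> > 0"
    and noise_var: "AE \<omega> in M. nn_cond_exp M (generated_sigma M X)
                      (\<lambda>\<omega>. ennreal ((norm (\<epsilon> \<omega>))\<^sup>2)) \<omega> \<le> ennreal (\<tau>\<^sup>2)"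
    and J: "legendre J"
    and x0: "x\<^sub>0 \<in> interior (effdom J)" and r: "r > 0"
    and B_int: "B \<subseteq> interior (effdom J)"
    and R: "R > 0" "\<forall>x\<in>B. norm (grad J x) \<le> R"
    and X_in_B: "AE \<omega> in M. X \<omega> \<in> B"
    and Z_meas: "Z \<in> borel_measurable (generated_sigma M X)"
    and beta: "\<beta> > 0"
    and source: "AE \<omega> in M. adjoint A (Z \<omega>) \<in> subdiff J (X \<omega>)"
    and Z_moment: "(\<integral>\<^sup>+\<omega>. ennreal ((norm (Z \<omega>))\<^sup>2) \<partial>M) \<le> ennreal (\<beta>\<^sup>2)"
    and N: "N \<ge> 2"
    and lam_pos: "0 < lam 1"
    and lam_mono: "mono_on {1..N} lam"
    and lam_grid: "\<forall>j\<in>{1..N}. lam j = lam 1 * Q ^ (j - 1)"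
    and lam_star: "\<tau> / \<beta> \<in> {lam 1..lam N}"
    and f_meas: "\<forall>l>0. f l \<in> borel_measurable borel"
    and f_min: "\<forall>l>0. AE \<omega> in M.
                  is_arg_min (\<lambda>x. ereal (1 / 2 * (norm (A x - Y \<omega>))\<^sup>2) + ereal l * J x)
                    (\<lambda>_. True) (f l (Y \<omega>))"
    and n: "n \<ge> 1"
    and indep: "prob_space.indep_vars M (\<lambda>_. borel \<Otimes>\<^sub>M borel) (\<lambda>i \<omega>. (Ys i \<omega>, Xs i \<omega>)) {1..n}"
    and copies: "\<forall>i\<in>{1..n}. distr M (borel \<Otimes>\<^sub>M borel) (\<lambda>\<omega>. (Ys i \<omega>, Xs i \<omega>)) =
                            distr M (borel \<Otimes>\<^sub>M borel) (\<lambda>\<omega>. (Y \<omega>, X \<omega>))"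
    and lam_hat_rv: "lam_hat \<in> measurable M (count_space (lam ` {1..N}))"
    and lam_hat_min: "AE \<omega> in M.
          is_arg_min (\<lambda>l. ereal (1 / real n) *
              (\<Sum>i=1..n. bregman_div J (bregman_proj J B (Xs i \<omega>)) (bregman_proj J B (f l (Ys i \<omega>)))))
            (\<lambda>l. l \<in> lam ` {1..N}) (lam_hat \<omega>)"
    and eta: "0 < \<eta>" "\<eta> < 1"
  shows "measure M {\<omega> \<in> space M.
           bregman_risk M J B X (\<lambda>\<omega>'. f (lam_hat \<omega>) (Y \<omega>'))
             \<le> ennreal ((1 + Q\<^sup>2) / Q * \<beta> * \<tau> + 26 * R * r / real n * ln (2 * real N / \<eta>))}
         \<ge> 1 - \<eta>"
proof -
  interpret prob_space M by (rule prob)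
  interpret legendre_function J by (rule legendre_function.intro[OF J])
  define \<Lambda> where "\<Lambda> = lam ` {1..N}"
  have \<Lambda>_pos: "l > 0" if "l \<in> \<Lambda>" for l
    using that N lam_pos mono_onD[OF lam_mono, of 1] unfolding \<Lambda>_def
    by (auto intro: less_le_trans)
  have Q1: "Q \<ge> 1"
    unfolding Q_def using mono_onD[OF lam_mono, of 1 N] N lam_pos
    by (intro ge_one_powr_ge_zero) auto
  have x0B: "x\<^sub>0 \<in> B" using r by (simp add: B_def)
  have clB: "closed B" "convex B" "bounded B" by (auto simp: B_def)
  \<comment> \<open>The statement is not random, so holding almost surely in a probability space
    makes it true. Connectedness of the ball then gives
    \<open>B \<subseteq> dom_sub\<close>.\<close>
  have "AE \<omega> in M. B \<inter> dom_sub \<noteq> {}"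
    using X_in_B source by eventually_elim (auto simp: op_dom_def)
  then have "B \<inter> dom_sub \<noteq> {}" by simp
  then have B_dom: "B \<subseteq> dom_sub"
    using R(2) by (intro connected_subset_dom_sub clB convex_connected) auto
  interpret bregman_projection J B
    using clB x0B B_dom by unfold_locales auto
  note loc = bregman_projection_axioms
  let ?P = "borel \<Otimes>\<^sub>M borel :: ('y \<times> 'x) measure"
  \<comment> \<open>\<open>h l\<close> is an everywhere defined Borel version of the loss with
    values in \<open>{0..C}\<close>; on \<open>G l\<close> no default is used and it equals the
    loss.\<close>
  define h where "h l w = D (if snd w \<in> B then snd w else x\<^sub>0)
      (if f l (fst w) \<in> dom_sub then proj (f l (fst w)) else x\<^sub>0)" for l and w :: "'y \<times> 'x"
  define G where "G l = {w \<in> space ?P. snd w \<in> B \<and> f l (fst w) \<in> dom_sub}" for l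
  define C where "C = 4 * R * r"
  have C: "C > 0" using R(1) r by (simp add: C_def)
  have fm: "f l \<in> borel_measurable borel" if "l > 0" for l using f_meas that by blast
  have h_meas: "h l \<in> borel_measurable ?P" if "l > 0" for l
  proof -
    note [measurable] = fm[OF that]
    have "(\<lambda>w. (\<lambda>(x, x'). D (if x \<in> B then x else x\<^sub>0) (if x' \<in> dom_sub then proj x' else x\<^sub>0))
        (snd w, f l (fst w))) \<in> borel_measurable ?P"
      by (rule measurable_compose[OF _ bregman_loss_measurable[OF loc x0B]]) measurable
    then show ?thesis by (simp add: h_def[abs_def])
  qed
  have h_range: "h l w \<in> {0..C}" for l w
  proof -
    have "(if snd w \<in> B then snd w else x\<^sub>0) \<in> B"
      "(if f l (fst w) \<in> dom_sub then proj (f l (fst w)) else x\<^sub>0) \<in> B"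
      using x0B proj_min(1) by auto
    then show ?thesis
      unfolding h_def C_def atLeastAtMost_iff using R(2) B_dom
      by (intro conjI D_nonneg D_le_diameter[of x\<^sub>0]) (auto simp: B_effdom B_def)
  qed
  have h_eq: "bregman_div J (proj x) (proj (f l y)) = ereal (h l (y, x))" if "(y, x) \<in> G l" for x y l
  proof -
    have "x \<in> B" "f l y \<in> dom_sub" using that by (auto simp: G_def)
    then show ?thesis
      using bregman_div_eq[OF B_effdom[of x], of "proj (f l y)"] proj_id[of x]
        proj_min(1)[of "f l y"] B_dom by (auto simp: h_def)
  qed
  have G: "G l \<in> sets ?P" if "l > 0" for l
  proof -
    note [measurable] = fm[OF that] borel_closed[OF clB(1)] borel_open[OF open_dom_sub]
    show ?thesis unfolding G_def by measurable
  qed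
  have rvYX: "(\<lambda>\<omega>. (Y \<omega>, X \<omega>)) \<in> measurable M ?P" using rv by measurable
  have rvi: "(\<lambda>\<omega>. (Ys i \<omega>, Xs i \<omega>)) \<in> measurable M ?P" if "i \<in> {1..n}" for i
    using indep that by (auto simp: indep_vars_def)
  have bound_AE: "AE \<omega> in M. (Y \<omega>, X \<omega>) \<in> G l \<and>
      h l (Y \<omega>, X \<omega>) \<le> l / 2 * (norm (Z \<omega>))\<^sup>2 + 1 / (2 * l) * (norm (\<epsilon> \<omega>))\<^sup>2" if l: "l > 0" for l
    using model X_in_B source f_min[rule_format, OF l]
  proof eventually_elim
    case (elim \<omega>)
    note * = D_proj_regularized_le[OF A(1) l elim(2,3) elim(4)[unfolded elim(1)]]
    show ?case
      using * elim(1,2) by (simp add: G_def h_def space_pair_measure)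
  qed
  \<comment> \<open>The minimization property is given for \<open>(Y, X)\<close>; membership in
    \<open>G l\<close> passes to the copies because it depends only on the distribution.\<close>
  have Gi_AE: "AE \<omega> in M. (Ys i \<omega>, Xs i \<omega>) \<in> G l" if l: "l > 0" and i: "i \<in> {1..n}" for l i
  proof -
    have pred: "{w \<in> space ?P. w \<in> G l} \<in> sets ?P"
      using G[OF l] by (simp add: G_def)
    have "AE w in distr M ?P (\<lambda>\<omega>. (Y \<omega>, X \<omega>)). w \<in> G l"
      unfolding AE_distr_iff[OF rvYX pred] using bound_AE[OF l] by eventually_elim simp
    then have "AE w in distr M ?P (\<lambda>\<omega>. (Ys i \<omega>, Xs i \<omega>)). w \<in> G l"
      unfolding copies[rule_format, OF i] .
    then show ?thesis unfolding AE_distr_iff[OF rvi[OF i] pred] .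
  qed
  define \<mu> where "\<mu> l = expectation (\<lambda>\<omega>. h l (Y \<omega>, X \<omega>))" for l
  have \<mu>_nn: "(\<integral>\<^sup>+\<omega>. ennreal (h l (Y \<omega>, X \<omega>)) \<partial>M) = ennreal (\<mu> l)" if "l > 0" for l
  proof -
    have "integrable M (\<lambda>\<omega>. h l (Y \<omega>, X \<omega>))"
      using h_range[of l] measurable_compose[OF rvYX h_meas[OF that]]
      by (intro integrable_const_bound[of _ C] AE_I2) auto
    then show ?thesis
      unfolding \<mu>_def using h_range by (intro nn_integral_eq_integral AE_I2) auto
  qed
  have risk: "bregman_risk M J B X (\<lambda>\<omega>. f l (Y \<omega>)) = ennreal (\<mu> l)" if l: "l > 0" for l
  proof -
    have "bregman_risk M J B X (\<lambda>\<omega>. f l (Y \<omega>)) = (\<integral>\<^sup>+\<omega>. ennreal (h l (Y \<omega>, X \<omega>)) \<partial>M)"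
      unfolding bregman_risk_def
    proof (rule nn_integral_cong_AE)
      show "AE \<omega> in M. e2ennreal (bregman_div J (proj (X \<omega>)) (proj (f l (Y \<omega>)))) = ennreal (h l (Y \<omega>, X \<omega>))"
        using bound_AE[OF l] by eventually_elim (simp add: h_eq)
    qed
    then show ?thesis using \<mu>_nn[OF l] by simp
  qed
  have sub: "subalgebra M (generated_sigma M X)"
    unfolding subalgebra_def sets_vimage_algebra
    using measurable_sets[OF rv(1)] by (intro conjI sets.sigma_sets_subset) auto
  interpret S: finite_measure_subalgebra M "generated_sigma M X"
    using sub by unfold_locales
  \<comment> \<open>Integrating the conditional second moment gives the unconditional bound
    \<open>\<tau>\<^sup>2\<close>.\<close>
  have "(\<integral>\<^sup>+\<omega>. ennreal ((norm (\<epsilon> \<omega>))\<^sup>2) \<partial>M) =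
      (\<integral>\<^sup>+\<omega>. nn_cond_exp M (generated_sigma M X) (\<lambda>\<omega>. ennreal ((norm (\<epsilon> \<omega>))\<^sup>2)) \<omega> \<partial>M)"
    using S.nn_cond_exp_intg[of "\<lambda>_. 1" "\<lambda>\<omega>. ennreal ((norm (\<epsilon> \<omega>))\<^sup>2)"] rv(2) by simp
  also have "\<dots> \<le> (\<integral>\<^sup>+\<omega>. ennreal (\<tau>\<^sup>2) \<partial>M)"
    using noise_var by (rule nn_integral_mono_AE)
  finally have noise_moment: "(\<integral>\<^sup>+\<omega>. ennreal ((norm (\<epsilon> \<omega>))\<^sup>2) \<partial>M) \<le> ennreal (\<tau>\<^sup>2)"
    by (simp add: emeasure_space_1)
  have Z_rv: "Z \<in> borel_measurable M" by (rule measurable_from_subalg[OF sub Z_meas])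
  have \<mu>_le: "\<mu> l \<le> l / 2 * \<beta>\<^sup>2 + 1 / (2 * l) * \<tau>\<^sup>2" if l: "l > 0" for l
  proof -
    have "ennreal (\<mu> l) \<le> (\<integral>\<^sup>+\<omega>. ennreal (l / 2) * ennreal ((norm (Z \<omega>))\<^sup>2)
        + ennreal (1 / (2 * l)) * ennreal ((norm (\<epsilon> \<omega>))\<^sup>2) \<partial>M)"
      unfolding \<mu>_nn[OF l, symmetric]
    proof (rule nn_integral_mono_AE)
      show "AE \<omega> in M. ennreal (h l (Y \<omega>, X \<omega>)) \<le> ennreal (l / 2) * ennreal ((norm (Z \<omega>))\<^sup>2)
          + ennreal (1 / (2 * l)) * ennreal ((norm (\<epsilon> \<omega>))\<^sup>2)"
        using bound_AE[OF l]
        by eventually_elim (use l in \<open>simp add: ennreal_mult[symmetric] ennreal_plus[symmetric] ennreal_leI del: ennreal_plus\<close>)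
    qed
    also have "\<dots> = ennreal (l / 2) * (\<integral>\<^sup>+\<omega>. ennreal ((norm (Z \<omega>))\<^sup>2) \<partial>M)
        + ennreal (1 / (2 * l)) * (\<integral>\<^sup>+\<omega>. ennreal ((norm (\<epsilon> \<omega>))\<^sup>2) \<partial>M)"
      using Z_rv rv(2) by (simp add: nn_integral_add nn_integral_cmult)
    also have "\<dots> \<le> ennreal (l / 2) * ennreal (\<beta>\<^sup>2) + ennreal (1 / (2 * l)) * ennreal (\<tau>\<^sup>2)"
      by (intro add_mono mult_left_mono Z_moment noise_moment) auto
    also have "\<dots> = ennreal (l / 2 * \<beta>\<^sup>2 + 1 / (2 * l) * \<tau>\<^sup>2)"
      using l by (simp add: ennreal_mult[symmetric] ennreal_plus[symmetric] del: ennreal_plus)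
    finally show ?thesis using l by (subst (asm) ennreal_le_iff) auto
  qed
  obtain m where m: "m \<in> {1..N}" and mQ: "lam m / (\<tau> / \<beta>) + (\<tau> / \<beta>) / lam m \<le> (1 + Q\<^sup>2) / Q"
    using geometric_grid_approximation[OF _ lam_pos Q1 lam_grid[rule_format] lam_star] N by auto
  have mL: "lam m \<in> \<Lambda>" using m by (simp add: \<Lambda>_def)
  \<comment> \<open>The factor \<open>2\<close> of the selection bound cancels the
    \<open>1/2\<close> in the risk bound, leaving
    \<open>lam m * \<beta>\<^sup>2 + \<tau>\<^sup>2 / lam m\<close>, which is
    \<open>\<beta> * \<tau>\<close> times the grid expression at
    \<open>s = \<tau> / \<beta>\<close>.\<close>
  have "2 * \<mu> (lam m) \<le> 2 * (lam m / 2 * \<beta>\<^sup>2 + 1 / (2 * lam m) * \<tau>\<^sup>2)"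
    using \<mu>_le[OF \<Lambda>_pos[OF mL]] by simp
  also have "\<dots> = (lam m / (\<tau> / \<beta>) + (\<tau> / \<beta>) / lam m) * (\<beta> * \<tau>)"
    using \<Lambda>_pos[OF mL] tau beta by (simp add: field_simps power2_eq_square)
  also have "\<dots> \<le> (1 + Q\<^sup>2) / Q * (\<beta> * \<tau>)"
    using mQ tau beta by (intro mult_right_mono) auto
  finally have best: "2 * \<mu> (lam m) \<le> (1 + Q\<^sup>2) / Q * \<beta> * \<tau>" by (simp only: mult.assoc)
  define c where "c = (1 + Q\<^sup>2) / Q * \<beta> * \<tau> + 26 * R * r / real n * ln (2 * real N / \<eta>)"
  have hat_\<Lambda>: "lam_hat \<omega> \<in> \<Lambda>" if "\<omega> \<in> space M" for \<omega>
    using measurable_space[OF lam_hat_rv that] by (simp add: \<Lambda>_def)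
  have "1 - \<eta> \<le> prob {\<omega>\<in>space M. \<mu> (lam_hat \<omega>) \<le>
      2 * \<mu> (lam m) + 4 * C / card {1..n} * ln ((2 * N :: nat) / \<eta>)}"
  proof (rule empirical_minimizer_risk_bound[where \<mu>=\<mu> and hat=lam_hat and k="lam m" and \<Lambda>=\<Lambda>
      and W="\<lambda>l i \<omega>. h l (Ys i \<omega>, Xs i \<omega>)"])
    show "card \<Lambda> < 2 * N"
      using card_image_le[of "{1..N}" lam] N by (simp add: \<Lambda>_def)
    show "indep_vars (\<lambda>_. borel) (\<lambda>i \<omega>. h l (Ys i \<omega>, Xs i \<omega>)) {1..n}" if "l \<in> \<Lambda>" for l
      by (rule indep_vars_compose2[OF indep h_meas[OF \<Lambda>_pos[OF that]]])
    show "expectation (\<lambda>\<omega>. h l (Ys i \<omega>, Xs i \<omega>)) = \<mu> l" if "l \<in> \<Lambda>" "i \<in> {1..n}" for l i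
      unfolding \<mu>_def
      using integral_distr[OF rvi[OF that(2)] h_meas[OF \<Lambda>_pos[OF that(1)]]]
        integral_distr[OF rvYX h_meas[OF \<Lambda>_pos[OF that(1)]]] copies[rule_format, OF that(2)]
      by simp
    show "lam_hat \<in> measurable M (count_space \<Lambda>)" using lam_hat_rv by (simp add: \<Lambda>_def)
    \<comment> \<open>Because \<open>lam_hat \<omega>\<close> depends on the sample, one null set
      must serve all parameters; finiteness of \<open>\<Lambda>\<close> allows this.\<close>
    have "AE \<omega> in M. \<forall>l\<in>\<Lambda>. \<forall>i\<in>{1..n}. (Ys i \<omega>, Xs i \<omega>) \<in> G l"
      using Gi_AE \<Lambda>_pos by (intro AE_finite_allI) (auto simp: \<Lambda>_def)
    then show "AE \<omega> in M. (\<Sum>i\<in>{1..n}. h (lam_hat \<omega>) (Ys i \<omega>, Xs i \<omega>)) \<le>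
        (\<Sum>i\<in>{1..n}. h (lam m) (Ys i \<omega>, Xs i \<omega>))"
      using lam_hat_min AE_space
    proof eventually_elim
      case (elim \<omega>)
      have e: "ereal (1 / real n) * (\<Sum>i=1..n. bregman_div J (proj (Xs i \<omega>)) (proj (f l (Ys i \<omega>)))) =
          ereal (1 / real n * (\<Sum>i=1..n. h l (Ys i \<omega>, Xs i \<omega>)))" if "l \<in> \<Lambda>" for l
      proof -
        have "(\<Sum>i=1..n. bregman_div J (proj (Xs i \<omega>)) (proj (f l (Ys i \<omega>)))) =
            (\<Sum>i=1..n. ereal (h l (Ys i \<omega>, Xs i \<omega>)))"
          using elim(1) that by (intro sum.cong h_eq) auto
        then show ?thesis by simp
      qed
      have "\<not> ereal (1 / real n * (\<Sum>i=1..n. h (lam m) (Ys i \<omega>, Xs i \<omega>)))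
          < ereal (1 / real n * (\<Sum>i=1..n. h (lam_hat \<omega>) (Ys i \<omega>, Xs i \<omega>)))"
        using elim(2) mL unfolding is_arg_min_def \<Lambda>_def[symmetric] e[OF mL, symmetric]
          e[OF hat_\<Lambda>[OF elim(3)], symmetric] by blast
      then show ?case using n by (simp add: not_less divide_le_cancel)
    qed
  qed (use n h_range C mL eta in \<open>auto simp: \<Lambda>_def\<close>)
  also have "\<dots> \<le> prob {\<omega>\<in>space M. bregman_risk M J B X (\<lambda>\<omega>'. f (lam_hat \<omega>) (Y \<omega>')) \<le> ennreal c}"
  proof (rule finite_measure_mono)
    \<comment> \<open>\<open>lam_hat\<close> is measurable into a discrete space, so every condition
      on its value defines an event.\<close>
    have "{\<omega>\<in>space M. bregman_risk M J B X (\<lambda>\<omega>'. f (lam_hat \<omega>) (Y \<omega>')) \<le> ennreal c} =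
        lam_hat -` {l\<in>\<Lambda>. bregman_risk M J B X (\<lambda>\<omega>'. f l (Y \<omega>')) \<le> ennreal c} \<inter> space M"
      using hat_\<Lambda> by auto
    also have "\<dots> \<in> events" by (rule measurable_sets[OF lam_hat_rv]) (auto simp: \<Lambda>_def)
    finally show "{\<omega>\<in>space M. bregman_risk M J B X (\<lambda>\<omega>'. f (lam_hat \<omega>) (Y \<omega>')) \<le> ennreal c} \<in> events" .
    \<comment> \<open>With \<open>C = 4 * R * r\<close> the error constant is
      \<open>16 * R * r\<close>; nonnegativity of the logarithm allows enlarging it to
      \<open>26 * R * r\<close>.\<close>
    have "ln (2 * real N / \<eta>) \<ge> 0" using N eta by (intro ln_ge_zero) (simp add: field_simps)
    then have "16 * (R * r / n * ln (2 * real N / \<eta>)) \<le> 26 * (R * r / n * ln (2 * real N / \<eta>))"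
      using R(1) r by (intro mult_right_mono mult_nonneg_nonneg) auto
    then have "2 * \<mu> (lam m) + 4 * C / card {1..n} * ln ((2 * N :: nat) / \<eta>) \<le> c"
      using best by (simp add: c_def C_def mult.assoc)
    then show "{\<omega>\<in>space M. \<mu> (lam_hat \<omega>) \<le> 2 * \<mu> (lam m) + 4 * C / card {1..n} * ln ((2 * N :: nat) / \<eta>)}
        \<subseteq> {\<omega>\<in>space M. bregman_risk M J B X (\<lambda>\<omega>'. f (lam_hat \<omega>) (Y \<omega>')) \<le> ennreal c}"
      using risk[OF \<Lambda>_pos[OF hat_\<Lambda>]] by (auto intro!: ennreal_leI)
  qed
  finally show ?thesis unfolding c_def .
qed

end
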